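(* There is no finite $5$-regular matchstick graph.
   Context: A matchstick graph is a simple graph drawn in the Euclidean plane, with distinct vertices placed at distinct points and each edge drawn as the straight line segment joining its endpoints, such that every edge has length exactly $1$ and non-adjacent edges do not intersect (so two distinct edges can meet only in a common endpoint). Graphs have a nonempty vertex set. A matchstick graph is $r$-regular if every vertex has degree $r$. *)

theory Defs
  imports "HOL-Analysis.Analysis"
begin

text \<open>A graph is a vertex set \<open>V\<close> with a set \<open>E\<close> of edges, an edge being the two-element set of
  its endpoints. Graphs may be infinite.\<close>

definition simple_graph :: "'a set \<Rightarrow> 'a set set \<Rightarrow> bool" where
  "simple_graph V E \<longleftrightarrow> V \<noteq> {} \<and> (\<forall>e\<in>E. e \<subseteq> V \<and> card e = 2)"

text \<open>The finiteness condition matters because \<^const>\<open>card\<close> is \<open>0\<close> on infinite sets.\<close>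

definition regular_graph :: "nat \<Rightarrow> 'a set \<Rightarrow> 'a set set \<Rightarrow> bool" where
  "regular_graph r V E \<longleftrightarrow> (\<forall>v\<in>V. finite {e \<in> E. v \<in> e} \<and> card {e \<in> E. v \<in> e} = r)"

text \<open>The map \<open>p\<close> places the vertices in the plane. Two distinct edges with a common endpoint
  need no condition: their drawings are unit segments from one point to two different points, so
  they meet only in that point.\<close>

definition matchstick_graph :: "'a set \<Rightarrow> 'a set set \<Rightarrow> ('a \<Rightarrow> real^2) \<Rightarrow> bool" where
  "matchstick_graph V E p \<longleftrightarrow>
     simple_graph V E \<and>
     inj_on p V \<and>
     (\<forall>u v. {u, v} \<in> E \<longrightarrow> dist (p u) (p v) = 1) \<and>
     (\<forall>u v x y. {u, v} \<in> E \<and> {x, y} \<in> E \<and> {u, v} \<inter> {x, y} = {} \<longrightarrow>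
        closed_segment (p u) (p v) \<inter> closed_segment (p x) (p y) = {})"

end

theory Submission
  imports Defs
begin

text \<open>A graph with \<open>n\<close> vertices, \<open>m\<close> edges and \<open>f\<close> faces drawn with straight edges satisfies
  \<open>f > m - n\<close>, which is the part of Euler's formula that expresses that cycles separate the plane.
  For a 5-regular graph \<open>m = 5n/2\<close>, so \<open>f > 3n/2\<close>. The contradiction is \<open>f \<le> 3n/2\<close>, obtained by
  weighing the corners of the faces: every vertex carries weight at most \<open>3/2\<close> and every face
  receives weight at least \<open>1\<close>.

  The weight of a corner depends only on its chord, the distance between the ends of the two unit
  edges forming it: \<open>1/3\<close> for chord \<open>1\<close> (angle 60 degrees), \<open>1/6\<close> for chord \<open>\<surd>3\<close> (angle 120
  degrees), and \<open>1/4\<close> otherwise. Reflex angles are treated as their complements to 360 degrees, so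
  no orientation has to be tracked. At a vertex, five corners of 60 degrees do not
  close up, and if four of them are 60 degrees then the fifth has chord \<open>\<surd>3\<close>; hence
  \<open>4/3 + 1/6 = 3/2\<close> or at most \<open>3/3 + 2/4 = 3/2\<close> (\<open>five_corners_weight\<close>). Around a face, a
  triangle has three corners of weight \<open>1/3\<close>; a quadrilateral is a rhombus, where a chord \<open>\<surd>3\<close>
  at one corner forces a chord \<open>1\<close> at the next; an equilateral pentagon has at most three corners
  with chord \<open>\<surd>3\<close>; and a walk with six or more corners has weight at least \<open>6/6\<close>
  (\<open>closed_walk_weight\<close>).

  The inequality \<open>f > m - n\<close> comes from counting even subgraphs, the edge sets that meet every
  vertex an even number of times. There are more than \<open>2^(m - n)\<close> of them, because the edge sets
  with given odd vertices form a coset of the even ones and a single vertex is never the set of odd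
  vertices. Each even subgraph two-colours the faces so that exactly its own edges separate
  different colours; thus it is determined by its colouring, and there are at most \<open>2^f\<close> of them
  (\<open>card_edges_less_vertices_plus_faces\<close>). The colouring is analytic: for an edge \<open>ab\<close> the
  function \<open>\<surd>((a - q)(b - q))\<close> of \<open>q\<close> has a branch that is continuous off the segment and changes sign
  across it, and the product of these branches over an even subgraph, divided by the polynomial in \<open>q\<close>
  that has the same square, is \<open>1\<close> or \<open>-1\<close> everywhere.

  Faces are connected components of the complement of the drawing. Each directed edge has a
  face on its left, and this face does not change when the boundary walk turns at a vertex into
  the next edge in clockwise order (\<open>rotation_at_vertex\<close>), so that every face contains the corners
  of a closed boundary walk.\<close>

section \<open>Weights of corners between unit edges\<close>

definition chord_weight :: "real \<Rightarrow> real" where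
  "chord_weight c = (if c = 1 then 1/3 else if c = sqrt 3 then 1/6 else 1/4)"

lemma chord_weight_bounds:
  "1/6 \<le> chord_weight c" "chord_weight c \<le> 1/3"
  "c \<noteq> 1 \<Longrightarrow> chord_weight c \<le> 1/4"
  by (auto simp: chord_weight_def)

lemma chord_weight_values: "chord_weight 1 = 1/3" "chord_weight (sqrt 3) = 1/6"
  by (auto simp: chord_weight_def)

lemma norm_eq_sqrt_iff:
  fixes z :: complex assumes "0 \<le> r"
  shows "norm z = sqrt r \<longleftrightarrow> (Re z)\<^sup>2 + (Im z)\<^sup>2 = r"
  using assms by (auto simp: cmod_def)

lemma norm_eq_1_iff: "norm (z::complex) = 1 \<longleftrightarrow> (Re z)\<^sup>2 + (Im z)\<^sup>2 = 1"
  using norm_eq_sqrt_iff[of 1 z] by simp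

lemma unit_chord_sqrt3:
  fixes x y :: complex
  assumes "norm x = 1" "norm y = 1"
  shows "norm (x + y) = sqrt 3 \<longleftrightarrow> norm (x - y) = 1"
  using assms unfolding norm_eq_1_iff norm_eq_sqrt_iff[OF order.trans[OF zero_le_one one_le_numeral]]
  by (auto simp: power2_eq_square algebra_simps)

text \<open>In the plane, two points have at most two common points at distance one; those are the roots
  of the quadratic equation satisfied by every unit vector \<open>u\<close> at distance one from \<open>w\<close>, and Vieta's
  formula gives their sum.\<close>

lemma rhombus_closure:
  fixes a b c d :: complex
  assumes "dist a b = 1" "dist b c = 1" "dist c d = 1" "dist d a = 1" "a \<noteq> c" "b \<noteq> d"
  shows "a + c = b + d"
proof -
  define x y w where "x = b - a" and "y = d - a" and "w = c - a"
  have circle: "cnj w * u\<^sup>2 - w * cnj w * u + w = 0" if "norm u = 1" "norm (u - w) = 1" for u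
  proof -
    have u: "u * cnj u = 1" and uw: "(u - w) * cnj (u - w) = 1"
      using that by (simp_all del: complex_cnj_diff flip: complex_norm_square)
    from uw u have "u * cnj w + w * cnj u - w * cnj w = 0" by (simp add: algebra_simps)
    then have "u * (u * cnj w + w * cnj u - w * cnj w) = 0" by simp
    moreover have "cnj w * u\<^sup>2 - w * cnj w * u + w * (u * cnj u)
        = u * (u * cnj w + w * cnj u - w * cnj w)"
      by (simp add: algebra_simps power2_eq_square)
    ultimately show ?thesis by (simp add: u)
  qed
  have "norm x = 1" "norm (x - w) = 1" "norm y = 1" "norm (y - w) = 1"
    using assms by (simp_all add: x_def y_def w_def dist_norm norm_minus_commute)
  note circle[OF this(1,2)] circle[OF this(3,4)]
  moreover have "cnj w * ((x - y) * (x + y - w))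
      = (cnj w * x\<^sup>2 - w * cnj w * x + w) - (cnj w * y\<^sup>2 - w * cnj w * y + w)"
    by (simp add: algebra_simps power2_eq_square)
  ultimately have "cnj w * ((x - y) * (x + y - w)) = 0" by simp
  moreover have "w \<noteq> 0" "x \<noteq> y" using assms by (auto simp: w_def x_def y_def)
  ultimately have "x + y = w" by simp
  then show ?thesis by (simp add: x_def y_def w_def algebra_simps)
qed

text \<open>The four points \<open>0, x, y, z\<close> form a rhombus: a double turn of 60 degrees is the linear
  recurrence \<open>z = y - x\<close>.\<close>

lemma sixty_degree_chain:
  fixes x y z :: complex
  assumes "norm x = 1" "norm z = 1" "dist x y = 1" "dist y z = 1" "x \<noteq> z" "y \<noteq> 0"
  shows "z = y - x"
  using rhombus_closure[of 0 x y z] assms by (auto simp: dist_commute algebra_simps)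

text \<open>Consecutive turns by 60 degrees cannot go back and forth, since the directions are distinct;
  so all four go the same way, and the first and last directions differ by 240 degrees.\<close>

lemma four_sixty_degree_corners:
  fixes z0 z1 z2 z3 z4 :: complex
  assumes "norm z0 = 1" "norm z1 = 1" "norm z2 = 1" "norm z3 = 1" "norm z4 = 1"
    and "z0 \<noteq> z2" "z1 \<noteq> z3" "z2 \<noteq> z4"
    and "dist z0 z1 = 1" "dist z1 z2 = 1" "dist z2 z3 = 1" "dist z3 z4 = 1"
  shows "dist z4 z0 = sqrt 3"
proof -
  have nz: "z1 \<noteq> 0" "z2 \<noteq> 0" "z3 \<noteq> 0" using assms by auto
  have "z2 = z1 - z0" "z3 = z2 - z1" "z4 = z3 - z2"
    using sixty_degree_chain[of z0 z2 z1] sixty_degree_chain[of z1 z3 z2]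
      sixty_degree_chain[of z2 z4 z3] assms nz by auto
  then have "z4 - z0 = - (z0 + z1)" by simp
  then have "dist z4 z0 = norm (z0 + z1)" by (simp only: dist_norm norm_minus_cancel)
  then show ?thesis
    using unit_chord_sqrt3[of z0 z1] assms by (simp add: dist_norm)
qed

lemma five_corners_weight:
  fixes z0 z1 z2 z3 z4 :: complex
  assumes "norm z0 = 1" "norm z1 = 1" "norm z2 = 1" "norm z3 = 1" "norm z4 = 1"
    and "distinct [z0, z1, z2, z3, z4]"
  shows "chord_weight (dist z0 z1) + chord_weight (dist z1 z2) + chord_weight (dist z2 z3)
    + chord_weight (dist z3 z4) + chord_weight (dist z4 z0) \<le> 3/2"
proof -
  have four: "chord_weight (dist e a) = 1/6"
    if "norm a = 1" "norm b = 1" "norm c = 1" "norm d = 1" "norm e = 1"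
      "a \<noteq> c" "b \<noteq> d" "c \<noteq> e" "dist a b = 1" "dist b c = 1" "dist c d = 1" "dist d e = 1"
    for a b c d e :: complex
    using four_sixty_degree_corners[OF that] by (simp add: chord_weight_values)
  have third: "chord_weight c \<le> 1/3" and quarter: "c = 1 \<or> chord_weight c \<le> 1/4" for c
    using chord_weight_bounds by blast+
  have ne: "z0 \<noteq> z2" "z1 \<noteq> z3" "z2 \<noteq> z4" "z3 \<noteq> z0" "z4 \<noteq> z1" using assms(6) by auto
  note n = assms(1-5)
  consider "dist z0 z1 = 1 \<and> dist z1 z2 = 1 \<and> dist z2 z3 = 1 \<and> dist z3 z4 = 1"
    | "dist z1 z2 = 1 \<and> dist z2 z3 = 1 \<and> dist z3 z4 = 1 \<and> dist z4 z0 = 1"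
    | "dist z2 z3 = 1 \<and> dist z3 z4 = 1 \<and> dist z4 z0 = 1 \<and> dist z0 z1 = 1"
    | "dist z3 z4 = 1 \<and> dist z4 z0 = 1 \<and> dist z0 z1 = 1 \<and> dist z1 z2 = 1"
    | "dist z4 z0 = 1 \<and> dist z0 z1 = 1 \<and> dist z1 z2 = 1 \<and> dist z2 z3 = 1"
    | "dist z0 z1 \<noteq> 1 \<and> dist z1 z2 \<noteq> 1" | "dist z0 z1 \<noteq> 1 \<and> dist z2 z3 \<noteq> 1"
    | "dist z0 z1 \<noteq> 1 \<and> dist z3 z4 \<noteq> 1" | "dist z0 z1 \<noteq> 1 \<and> dist z4 z0 \<noteq> 1"
    | "dist z1 z2 \<noteq> 1 \<and> dist z2 z3 \<noteq> 1" | "dist z1 z2 \<noteq> 1 \<and> dist z3 z4 \<noteq> 1"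
    | "dist z1 z2 \<noteq> 1 \<and> dist z4 z0 \<noteq> 1" | "dist z2 z3 \<noteq> 1 \<and> dist z3 z4 \<noteq> 1"
    | "dist z2 z3 \<noteq> 1 \<and> dist z4 z0 \<noteq> 1" | "dist z3 z4 \<noteq> 1 \<and> dist z4 z0 \<noteq> 1"
    by blast
  then show ?thesis
  proof cases
    case 1
    then have "chord_weight (dist z4 z0) = 1/6" using four[of z0 z1 z2 z3 z4] n ne by blast
    then show ?thesis using 1 by (simp add: chord_weight_values)
  next
    case 2
    then have "chord_weight (dist z0 z1) = 1/6" using four[of z1 z2 z3 z4 z0] n ne by blast
    then show ?thesis using 2 by (simp add: chord_weight_values)
  next
    case 3
    then have "chord_weight (dist z1 z2) = 1/6" using four[of z2 z3 z4 z0 z1] n ne by blast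
    then show ?thesis using 3 by (simp add: chord_weight_values)
  next
    case 4
    then have "chord_weight (dist z2 z3) = 1/6" using four[of z3 z4 z0 z1 z2] n ne by blast
    then show ?thesis using 4 by (simp add: chord_weight_values)
  next
    case 5
    then have "chord_weight (dist z3 z4) = 1/6" using four[of z4 z0 z1 z2 z3] n ne by blast
    then show ?thesis using 5 by (simp add: chord_weight_values)
  qed (use third[of "dist z0 z1"] third[of "dist z1 z2"] third[of "dist z2 z3"] third[of "dist z3 z4"]
      third[of "dist z4 z0"] quarter[of "dist z0 z1"] quarter[of "dist z1 z2"] quarter[of "dist z2 z3"]
      quarter[of "dist z3 z4"] quarter[of "dist z4 z0"] in linarith)+
qed

text \<open>Two unit vectors at 60 degrees generate a triangular lattice, whose norm form is
  \<open>r\<^sup>2 + r s + s\<^sup>2\<close>.\<close>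

lemma unit_sixty_independent:
  fixes x y :: complex and r s :: real
  assumes "norm x = 1" "norm y = 1" "norm (x - y) = 1" "of_real r * x + of_real s * y = 0"
  shows "r = 0 \<and> s = 0"
proof -
  have xy: "2 * (Re x * Re y + Im x * Im y) = 1"
    using assms(1-3) unfolding norm_eq_1_iff by (simp add: power2_eq_square algebra_simps)
  have "(norm (of_real r * x + of_real s * y))\<^sup>2
      = r\<^sup>2 * ((Re x)\<^sup>2 + (Im x)\<^sup>2) + s\<^sup>2 * ((Re y)\<^sup>2 + (Im y)\<^sup>2) + r * s * (2 * (Re x * Re y + Im x * Im y))"
    unfolding cmod_power2 by (simp add: power2_eq_square algebra_simps)
  also have "\<dots> = r\<^sup>2 + s\<^sup>2 + r * s"
    using assms(1,2) xy unfolding norm_eq_1_iff by simp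
  finally have "r\<^sup>2 + s\<^sup>2 + r * s = 0" using assms(4) by simp
  then have "(r + s / 2)\<^sup>2 + 3 / 4 * s\<^sup>2 = 0" by (simp add: power2_eq_square algebra_simps)
  then have "s\<^sup>2 = 0" "(r + s / 2)\<^sup>2 = 0"
    using zero_le_power2[of s] zero_le_power2[of "r + s / 2"] by linarith+
  then show ?thesis by simp
qed

text \<open>A chord \<open>\<surd>3\<close> between two unit edges means that the walk turns by 60 degrees, left or right.
  After four such turns all five steps lie in the lattice of the first two, and the list of
  possible turns shows that their sum never vanishes. This excludes pentagons with four corners of
  chord \<open>\<surd>3\<close>.\<close>

lemma four_unit_steps_turning_sixty:
  fixes e0 e1 e2 e3 e4 :: complex
  assumes "norm e0 = 1" "norm e1 = 1" "norm e2 = 1" "norm e3 = 1" "norm e4 = 1"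
    and "dist e0 e1 = 1" "dist e1 e2 = 1" "dist e2 e3 = 1" "dist e3 e4 = 1"
  shows "e0 + e1 + e2 + e3 + e4 \<noteq> 0"
proof
  assume sum0: "e0 + e1 + e2 + e3 + e4 = 0"
  have nz: "e1 \<noteq> 0" "e2 \<noteq> 0" "e3 \<noteq> 0" using assms by auto
  have e2: "e2 = e0 \<or> e2 = e1 - e0" and e3: "e3 = e1 \<or> e3 = e2 - e1" and e4: "e4 = e2 \<or> e4 = e3 - e2"
    using sixty_degree_chain[of e0 e2 e1] sixty_degree_chain[of e1 e3 e2]
      sixty_degree_chain[of e2 e4 e3] assms nz by auto
  have indep: "r = 0 \<and> s = 0" if "of_real r * e0 + of_real s * e1 = 0" for r s
    using unit_sixty_independent[OF _ _ _ that] assms by (simp add: dist_norm)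
  show False
    using e2 e3 e4 sum0 indep[of 3 2] indep[of 1 3] indep[of 4 0] indep[of 3 "-1"] indep[of "-1" 4]
      indep[of "-2" 3] indep[of "-1" 1]
    by (elim disjE) (simp_all add: algebra_simps)
qed

lemma equilateral_pentagon_weight:
  fixes a :: "nat \<Rightarrow> complex"
  assumes unit: "\<And>i. dist (a i) (a (Suc i)) = 1" and per: "\<And>i. a (i + 5) = a i"
  shows "1 \<le> (\<Sum>i<5. chord_weight (dist (a i) (a (Suc (Suc i)))))"
proof -
  define c where "c i = dist (a i) (a (Suc (Suc i)))" for i
  \<comment> \<open>the step vectors at four consecutive corners with chord \<open>\<surd>3\<close> would sum to zero\<close>
  have no4: "\<not> (c i = sqrt 3 \<and> c (Suc i) = sqrt 3 \<and> c (i+2) = sqrt 3 \<and> c (i+3) = sqrt 3)" for i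
  proof
    assume asm: "c i = sqrt 3 \<and> c (Suc i) = sqrt 3 \<and> c (i+2) = sqrt 3 \<and> c (i+3) = sqrt 3"
    define e where "e j = a (Suc j) - a j" for j
    have ne: "norm (e j) = 1" for j
      using unit[of j] by (simp add: e_def dist_norm norm_minus_commute)
    have turn: "dist (e j) (e (Suc j)) = 1" if "c j = sqrt 3" for j
    proof -
      have "norm (e j + e (Suc j)) = c j" by (simp add: e_def c_def dist_norm norm_minus_commute)
      with that show ?thesis using unit_chord_sqrt3[OF ne ne] by (simp add: dist_norm)
    qed
    have "e i + e (i+1) + e (i+2) + e (i+3) + e (i+4) \<noteq> 0"
      by (rule four_unit_steps_turning_sixty)
         (use ne turn[of i] turn[of "i+1"] turn[of "i+2"] turn[of "i+3"] asm in \<open>auto simp: eval_nat_numeral\<close>)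
    moreover have "e i + e (i+1) + e (i+2) + e (i+3) + e (i+4) = 0"
      using per[of i] by (simp add: e_def eval_nat_numeral)
    ultimately show False by simp
  qed
  have per': "c (i + 5) = c i" for i
    using per[of i] per[of "Suc (Suc i)"] by (simp add: c_def)
  have n: "c 5 = c 0" "c 6 = c 1" "c 7 = c 2"
    using per'[of 0] per'[of 1] per'[of 2] by simp_all
  have lb: "(if c i = sqrt 3 then 1/6 else 1/4) \<le> chord_weight (c i)" for i
    by (auto simp: chord_weight_def)
  have five: "{..<5} = {0, 1, 2, 3, 4 :: nat}" by auto
  have "\<not> (c 0 = sqrt 3 \<and> c 1 = sqrt 3 \<and> c 2 = sqrt 3 \<and> c 3 = sqrt 3)"
    "\<not> (c 1 = sqrt 3 \<and> c 2 = sqrt 3 \<and> c 3 = sqrt 3 \<and> c 4 = sqrt 3)"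
    "\<not> (c 2 = sqrt 3 \<and> c 3 = sqrt 3 \<and> c 4 = sqrt 3 \<and> c 0 = sqrt 3)"
    "\<not> (c 3 = sqrt 3 \<and> c 4 = sqrt 3 \<and> c 0 = sqrt 3 \<and> c 1 = sqrt 3)"
    "\<not> (c 4 = sqrt 3 \<and> c 0 = sqrt 3 \<and> c 1 = sqrt 3 \<and> c 2 = sqrt 3)"
    using no4[of 0] no4[of 1] no4[of 2] no4[of 3] no4[of 4] n by (simp_all add: numeral_eq_Suc)
  then have "1 \<le> (\<Sum>i<5. if c i = sqrt 3 then 1/6 else 1/4 :: real)"
    unfolding five by auto
  also have "\<dots> \<le> (\<Sum>i<5. chord_weight (c i))" by (intro sum_mono lb)
  finally show ?thesis by (simp add: c_def)
qed

text \<open>The walk is given as an infinite periodic sequence, so that the corner between its last and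
  first edge needs no special treatment.\<close>

lemma closed_walk_weight:
  fixes a :: "nat \<Rightarrow> complex"
  assumes unit: "\<And>i. dist (a i) (a (Suc i)) = 1"
    and turns: "\<And>i. a i \<noteq> a (Suc (Suc i))"
    and per: "\<And>i. a (i + k) = a i" and "k > 0"
  shows "1 \<le> (\<Sum>i<k. chord_weight (dist (a i) (a (Suc (Suc i)))))"
proof -
  have "k \<noteq> 1" using per[of 0] unit[of 0] by auto
  moreover have "k \<noteq> 2" using per[of 0] turns[of 0] by (auto simp: eval_nat_numeral)
  ultimately consider "k = 3" | "k = 4" | "k = 5" | "k \<ge> 6" using \<open>k > 0\<close> by linarith
  then show ?thesis
  proof cases
    case 1
    have "dist (a i) (a (Suc (Suc i))) = 1" for i
      using unit[of "i + 2"] per[of i] 1 by (simp add: eval_nat_numeral dist_commute)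
    then show ?thesis using 1 by (simp add: chord_weight_values)
  next
    case 2
    have p: "a 4 = a 0" "a 5 = a 1" using per[of 0] per[of 1] 2 by simp_all
    have u: "dist (a 0) (a 1) = 1" "dist (a 1) (a 2) = 1" "dist (a 2) (a 3) = 1" "dist (a 3) (a 0) = 1"
      using unit[of 0] unit[of 1] unit[of 2] unit[of 3] p by (simp_all add: eval_nat_numeral)
    have ne: "a 0 \<noteq> a 2" "a 1 \<noteq> a 3" using turns[of 0] turns[of 1] by (simp_all add: eval_nat_numeral)
    have par: "a 0 + a 2 = a 1 + a 3" by (rule rhombus_closure[OF u ne])
    define x y where "x = a 1 - a 0" and "y = a 2 - a 1"
    have xy: "norm x = 1" "norm y = 1" using u by (simp_all add: x_def y_def dist_norm norm_minus_commute)
    have d: "dist (a 0) (a 2) = norm (x + y)" "dist (a 1) (a 3) = norm (x - y)"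
    proof -
      show "dist (a 0) (a 2) = norm (x + y)" by (simp add: x_def y_def dist_norm norm_minus_commute)
      have "x - y = a 1 - a 3" using par by (simp add: x_def y_def algebra_simps)
      then show "dist (a 1) (a 3) = norm (x - y)" by (simp add: dist_norm)
    qed
    have "(\<Sum>i<k. chord_weight (dist (a i) (a (Suc (Suc i)))))
      = 2 * (chord_weight (norm (x + y)) + chord_weight (norm (x - y)))"
      using d p unfolding 2 by (simp add: eval_nat_numeral dist_commute)
    \<comment> \<open>the diagonals satisfy the parallelogram law, so one is \<open>\<surd>3\<close> exactly if the other is \<open>1\<close>\<close>
    also have "\<dots> \<ge> 1"
      using unit_chord_sqrt3[of x y] unit_chord_sqrt3[of x "- y"] xy
      by (auto simp: chord_weight_def)
    finally show ?thesis .
  next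
    case 3
    then show ?thesis using equilateral_pentagon_weight[of a, OF unit] per by simp
  next
    case 4
    have "1 \<le> (\<Sum>i<k. 1/6 :: real)" using 4 by simp
    also have "\<dots> \<le> (\<Sum>i<k. chord_weight (dist (a i) (a (Suc (Suc i)))))"
      by (intro sum_mono chord_weight_bounds)
    finally show ?thesis .
  qed
qed

section \<open>A square root that changes sign across a segment\<close>

text \<open>A branch of \<open>\<surd>((a - q)(b - q))\<close>, arranged so that the cut of \<^const>\<open>csqrt\<close> along the
  negative axis becomes the segment from \<open>a\<close> to \<open>b\<close>.\<close>

definition edge_root :: "complex \<Rightarrow> complex \<Rightarrow> complex \<Rightarrow> complex" where
  "edge_root a b q = (a - q) * csqrt ((b - q) / (a - q))"

lemma edge_root_square: "q \<noteq> a \<Longrightarrow> (edge_root a b q)\<^sup>2 = (a - q) * (b - q)"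
  unfolding edge_root_def power_mult_distrib power2_csqrt by (simp add: power2_eq_square)

lemma edge_root_nonzero: "q \<noteq> a \<Longrightarrow> q \<noteq> b \<Longrightarrow> edge_root a b q \<noteq> 0"
  by (simp add: edge_root_def)

lemma quotient_nonpos_imp_in_segment:
  fixes a b q :: complex
  assumes "(b - q) / (a - q) \<in> \<real>\<^sub>\<le>\<^sub>0" "q \<noteq> a"
  shows "q \<in> closed_segment a b"
proof -
  obtain t where t: "t \<le> 0" "(b - q) / (a - q) = of_real t"
    using assms(1) by (auto elim: nonpos_Reals_cases)
  then have "b - q = of_real t * (a - q)" using assms(2) by (simp add: field_simps)
  then have "of_real (1 - t) * q = b - of_real t * a" by (simp add: algebra_simps)
  moreover define u where "u = 1 / (1 - t)"
  have cu: "complex_of_real (1 - t) * of_real u = 1"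
    unfolding of_real_mult[symmetric] using t(1) by (simp add: u_def)
  have "of_real (1 - t) * (of_real (1 - u) * a + of_real u * b)
      = of_real (1 - t) * a - (of_real (1 - t) * of_real u) * a + (of_real (1 - t) * of_real u) * b"
    by (simp add: algebra_simps)
  then have "of_real (1 - t) * (of_real (1 - u) * a + of_real u * b) = b - of_real t * a"
    unfolding cu by (simp add: algebra_simps)
  ultimately have "q = of_real (1 - u) * a + of_real u * b"
    using cu by (metis mult_cancel_left mult_zero_left zero_neq_one)
  then show ?thesis
    unfolding in_segment using t(1)
    by (intro exI[of _ u]) (auto simp: u_def scaleR_conv_of_real field_simps)
qed

lemma isCont_edge_root:
  assumes "q \<notin> closed_segment a b"
  shows "isCont (edge_root a b) q"
proof -
  have qa: "q \<noteq> a" using assms by auto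
  have "isCont (\<lambda>z. (b - z) / (a - z)) q" using qa by (intro continuous_intros) auto
  then have "isCont (\<lambda>z. csqrt ((b - z) / (a - z))) q"
    using quotient_nonpos_imp_in_segment[of b q a] assms qa by (intro isCont_csqrt') auto
  then show ?thesis unfolding edge_root_def [abs_def] by (intro continuous_intros)
qed

text \<open>The point at signed distance proportional to \<open>s\<close> from the midpoint, to the left of the
  direction from \<open>a\<close> to \<open>b\<close> when \<open>s\<close> is positive.\<close>

definition beside :: "complex \<Rightarrow> complex \<Rightarrow> real \<Rightarrow> complex" where
  "beside a b s = a + (b - a) * (1/2 + \<i> * of_real s)"

lemma beside_swap: "beside b a s = beside a b (- s)"
  by (simp add: beside_def field_simps)

lemma beside_ne_ends:
  assumes "a \<noteq> b" shows "beside a b s \<noteq> a" "beside a b s \<noteq> b"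
proof -
  have *: "1/2 + \<i> * of_real s \<noteq> 0" "1/2 + \<i> * of_real s \<noteq> 1" by (auto simp: complex_eq_iff)
  show "beside a b s \<noteq> a" using * assms by (simp add: beside_def)
  show "beside a b s \<noteq> b"
  proof
    assume "beside a b s = b"
    then have "(b - a) * (1/2 + \<i> * of_real s) = (b - a) * 1" by (simp add: beside_def algebra_simps)
    with * assms show False by (metis mult_cancel_left right_minus_eq)
  qed
qed

text \<open>Reflecting \<open>q\<close> in the segment conjugates the quotient \<open>R = (b - q)/(a - q)\<close>. On the
  perpendicular bisector \<open>R\<close> has modulus one, so the square root changes from \<open>c\<close> to \<open>1/c\<close> where
  \<open>c\<^sup>2 = R\<close>, and the factor \<open>a - q\<close> turns this into an exact change of sign.\<close>

lemma edge_root_jump: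
  assumes "a \<noteq> b" "s \<noteq> 0"
  shows "edge_root a b (beside a b (- s)) = - edge_root a b (beside a b s)"
proof -
  define z where "z = 1/2 + \<i> * of_real s"
  define R where "R = (z - 1) / z"
  have z: "z \<noteq> 0" "cnj z \<noteq> 0" "z - 1 = - cnj z" "1 - z = cnj z"
    by (auto simp: z_def complex_eq_iff)
  have R: "R = - cnj z / z" by (simp add: R_def z)
  have "norm R = 1" using z by (simp add: R norm_divide)
  have right: "a - beside a b s = - (b - a) * z" "b - beside a b s = - (b - a) * (z - 1)"
    and left: "a - beside a b (- s) = - (b - a) * cnj z" "b - beside a b (- s) = - (b - a) * (cnj z - 1)"
    by (simp_all add: beside_def z_def field_simps)
  have quot: "(b - beside a b s) / (a - beside a b s) = R"
    "(b - beside a b (- s)) / (a - beside a b (- s)) = cnj R"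
    unfolding right left R_def using assms(1) by simp_all
  have "R \<notin> \<real>\<^sub>\<le>\<^sub>0"
  proof
    assume "R \<in> \<real>\<^sub>\<le>\<^sub>0"
    then obtain t where "R = of_real t" by (auto elim: nonpos_Reals_cases)
    then have "- cnj z = of_real t * z" using z R by (simp add: field_simps)
    from arg_cong[OF this, of Re] arg_cong[OF this, of Im] show False
      using assms(2) by (auto simp: z_def)
  qed
  then have c: "csqrt (cnj R) = cnj (csqrt R)" by (simp add: cnj_csqrt)
  have "csqrt R * cnj (csqrt R) = 1"
    using \<open>norm R = 1\<close> by (simp flip: complex_norm_square)
  then have "csqrt R * (cnj z * cnj (csqrt R)) = csqrt R * (- z * csqrt R)"
    using z R by (simp add: mult.left_commute flip: power2_eq_square)
  moreover have "csqrt R \<noteq> 0" using \<open>norm R = 1\<close> by auto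
  ultimately have "cnj z * cnj (csqrt R) = - z * csqrt R" using mult_left_cancel by blast
  then show ?thesis
    unfolding edge_root_def quot unfolding c right(1) left(1)
    by (metis (no_types, lifting) minus_mult_left minus_mult_right mult.assoc)
qed

section \<open>Signs of even subgraphs\<close>

text \<open>An edge, as a set of two points, is drawn as its convex hull, which is the segment between its
  ends.\<close>

locale straight_line_graph =
  fixes V :: "complex set" and E :: "complex set set"
  assumes finite_V: "finite V"
    and edge_subset: "e \<in> E \<Longrightarrow> e \<subseteq> V" and card_edge: "e \<in> E \<Longrightarrow> card e = 2"
    and edges_meet: "e \<in> E \<Longrightarrow> e' \<in> E \<Longrightarrow> e \<noteq> e' \<Longrightarrow> convex hull e \<inter> convex hull e' \<subseteq> e \<inter> e'"
begin

definition drawing :: "complex set" where "drawing = (\<Union>e\<in>E. convex hull e)"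

definition deg :: "complex set set \<Rightarrow> complex \<Rightarrow> nat" where "deg A v = card {e \<in> A. v \<in> e}"

lemma finite_E: "finite E"
  using finite_subset[of E "Pow V"] finite_V edge_subset by blast

lemma edge_cases:
  assumes "e \<in> E" obtains a b where "e = {a, b}" "a \<noteq> b"
  using card_edge[OF assms] by (auto simp: card_2_iff)

lemma edge_ne: "{a, b} \<in> E \<Longrightarrow> a \<noteq> b"
  using card_edge[of "{a, b}"] by auto

text \<open>The branch \<^const>\<open>edge_root\<close> depends on a direction of the edge; any fixed choice
  will do.\<close>

definition tail where "tail e = (SOME a. a \<in> (e::complex set))"
definition head where "head e = (SOME b. e = {tail e, b})"

lemma ends: assumes "e \<in> E" shows "e = {tail e, head e}"
proof -
  obtain a b where e: "e = {a, b}" using edge_cases[OF assms] by metis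
  then have "tail e \<in> e" unfolding tail_def by (intro someI) auto
  then have "\<exists>b. e = {tail e, b}" using e by auto
  then show ?thesis unfolding head_def by (rule someI_ex)
qed

lemma ends_ne: "e \<in> E \<Longrightarrow> tail e \<noteq> head e"
  using ends edge_ne by metis

lemma hull_edge: "e \<in> E \<Longrightarrow> convex hull e = closed_segment (tail e) (head e)"
  using ends[of e] by (metis segment_convex_hull)

text \<open>The numerator squares to the product of \<open>(v - q)\<close> taken \<open>deg A v\<close> times over all vertices \<open>v\<close>.
  When all these degrees are even, the denominator has the same square.\<close>

definition side_sign :: "complex set set \<Rightarrow> complex \<Rightarrow> complex" where
  "side_sign A q = (\<Prod>e\<in>A. edge_root (tail e) (head e) q) / (\<Prod>v\<in>V. (v - q) ^ (deg A v div 2))"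

lemma prod_edges_prod_ends:
  fixes h :: "complex \<Rightarrow> 'b :: comm_semiring_1"
  assumes "A \<subseteq> E"
  shows "(\<Prod>e\<in>A. \<Prod>v\<in>e. h v) = (\<Prod>v\<in>V. h v ^ deg A v)"
proof -
  have fA: "finite A" using assms finite_E finite_subset by blast
  have "(\<Prod>e\<in>A. \<Prod>v\<in>e. h v) = (\<Prod>e\<in>A. \<Prod>v | v \<in> V \<and> v \<in> e. h v)"
    by (intro prod.cong refl) (use assms edge_subset in blast)
  also have "\<dots> = (\<Prod>v\<in>V. \<Prod>e | e \<in> A \<and> v \<in> e. h v)"
    by (rule prod.swap_restrict[OF fA finite_V])
  finally show ?thesis by (simp add: deg_def)
qed

lemma isCont_vertex_part:
  assumes "\<And>e. e \<in> A \<Longrightarrow> q \<notin> e"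
  shows "isCont (\<lambda>q. \<Prod>v\<in>V. (v - q) ^ (deg A v div 2)) q" "(\<Prod>v\<in>V. (v - q) ^ (deg A v div 2)) \<noteq> 0"
proof -
  show "isCont (\<lambda>q. \<Prod>v\<in>V. (v - q) ^ (deg A v div 2)) q" by (intro continuous_intros)
  have "(v - q) ^ (deg A v div 2) \<noteq> 0" for v
  proof (cases "v = q")
    case True
    then have "{e \<in> A. v \<in> e} = {}" using assms by auto
    then have "deg A v = 0" unfolding deg_def by (simp only: card.empty)
    then show ?thesis by simp
  qed simp
  then show "(\<Prod>v\<in>V. (v - q) ^ (deg A v div 2)) \<noteq> 0" using finite_V by simp
qed

lemma side_sign_square:
  assumes A: "A \<subseteq> E" and even: "\<And>v. v \<in> V \<Longrightarrow> even (deg A v)"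
    and q: "\<And>e. e \<in> A \<Longrightarrow> q \<notin> e"
  shows "(side_sign A q)\<^sup>2 = 1"
proof -
  have "(\<Prod>e\<in>A. edge_root (tail e) (head e) q)\<^sup>2 = (\<Prod>e\<in>A. \<Prod>v\<in>e. v - q)"
    unfolding prod_power_distrib
  proof (intro prod.cong refl)
    fix e assume e: "e \<in> A"
    then have "tail e \<noteq> q" using q[OF e] ends[of e] A by blast
    then have "(edge_root (tail e) (head e) q)\<^sup>2 = (\<Prod>v\<in>{tail e, head e}. v - q)"
      using ends_ne[of e] e A by (auto simp: edge_root_square)
    then show "(edge_root (tail e) (head e) q)\<^sup>2 = (\<Prod>v\<in>e. v - q)"
      using ends[of e] e A by auto
  qed
  also have "\<dots> = (\<Prod>v\<in>V. (v - q) ^ deg A v)" by (rule prod_edges_prod_ends[OF A])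
  also have "\<dots> = (\<Prod>v\<in>V. (v - q) ^ (deg A v div 2))\<^sup>2"
    unfolding prod_power_distrib
    by (intro prod.cong refl) (use even in \<open>simp flip: power_mult\<close>)
  finally have "(\<Prod>e\<in>A. edge_root (tail e) (head e) q)\<^sup>2 = (\<Prod>v\<in>V. (v - q) ^ (deg A v div 2))\<^sup>2" .
  with isCont_vertex_part(2)[of A q] q show ?thesis by (simp add: side_sign_def power_divide)
qed

lemma isCont_edge_part:
  assumes "A \<subseteq> E" "\<And>e. e \<in> A \<Longrightarrow> q \<notin> convex hull e"
  shows "isCont (\<lambda>q. \<Prod>e\<in>A. edge_root (tail e) (head e) q) q"
    "(\<Prod>e\<in>A. edge_root (tail e) (head e) q) \<noteq> 0"
proof -
  have seg: "q \<notin> closed_segment (tail e) (head e)" if "e \<in> A" for e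
    using assms that hull_edge by blast
  show "isCont (\<lambda>q. \<Prod>e\<in>A. edge_root (tail e) (head e) q) q"
    by (intro continuous_prod isCont_edge_root seg)
  have "edge_root (tail e) (head e) q \<noteq> 0" if "e \<in> A" for e
    using seg[OF that] by (intro edge_root_nonzero) auto
  moreover have "finite A" using assms(1) finite_E finite_subset by blast
  ultimately show "(\<Prod>e\<in>A. edge_root (tail e) (head e) q) \<noteq> 0" by simp
qed

lemma isCont_side_sign:
  assumes "A \<subseteq> E" "\<And>e. e \<in> A \<Longrightarrow> q \<notin> convex hull e"
  shows "isCont (side_sign A) q"
proof -
  have "q \<notin> e" if "e \<in> A" for e using assms(2)[OF that] hull_inc by metis
  then show ?thesis
    unfolding side_sign_def [abs_def] using isCont_edge_part(1)[OF assms] isCont_vertex_part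
    by (intro isCont_divide) auto
qed

lemma midpoint_off_other_edges:
  assumes "{a, b} \<in> E" "e \<in> E" "e \<noteq> {a, b}"
  shows "beside a b 0 \<notin> convex hull e"
proof
  assume m: "beside a b 0 \<in> convex hull e"
  have "beside a b 0 = (1 - 1/2) *\<^sub>R a + (1/2) *\<^sub>R b"
    by (simp add: beside_def scaleR_conv_of_real field_simps)
  then have "beside a b 0 \<in> closed_segment a b" unfolding in_segment by (intro exI[of _ "1/2"]) auto
  with m have "beside a b 0 \<in> {a, b}"
    using edges_meet[OF assms(1,2)] assms(3) by (auto simp: segment_convex_hull)
  then show False using edge_ne[OF assms(1)] by (auto simp: beside_def field_simps)
qed

lemma edge_root_ends_jump:
  assumes "{a, b} \<in> E" "s \<noteq> 0"
  shows "edge_root (tail {a, b}) (head {a, b}) (beside a b (- s))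
    = - edge_root (tail {a, b}) (head {a, b}) (beside a b s)"
proof -
  have "tail {a, b} = a \<and> head {a, b} = b \<or> tail {a, b} = b \<and> head {a, b} = a"
    using ends[OF assms(1)] by (metis doubleton_eq_iff)
  then show ?thesis
    using edge_root_jump[of a b s] edge_root_jump[of b a "- s"] edge_ne[OF assms(1)] assms(2)
    by (auto simp: beside_swap[of b a])
qed

text \<open>Only the factor of the edge \<open>{a, b}\<close> itself jumps; all others are continuous and nonzero at its midpoint,
  which lies on no other edge.\<close>

lemma side_sign_jump:
  assumes A: "A \<subseteq> E" and ab: "{a, b} \<in> E"
  shows "((\<lambda>s. side_sign A (beside a b (- s)) / side_sign A (beside a b s))
    \<longlongrightarrow> (if {a, b} \<in> A then - 1 else 1)) (at_right 0)"
proof -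
  define m where "m = beside a b 0"
  define B where "B = A - {{a, b}}"
  have BE: "B \<subseteq> E" and fA: "finite A" using A finite_E finite_subset by (auto simp: B_def)
  have off: "m \<notin> convex hull e" if "e \<in> B" for e
    using midpoint_off_other_edges[OF ab] that A by (auto simp: B_def m_def)
  have "m \<noteq> a" "m \<noteq> b" using edge_ne[OF ab] by (auto simp: m_def beside_def field_simps)
  then have offv: "m \<notin> e" if "e \<in> A" for e
    using that off[of e] hull_inc[of m e] by (cases "e = {a, b}") (auto simp: B_def)
  define Q where "Q q = (\<Prod>e\<in>B. edge_root (tail e) (head e) q) / (\<Prod>v\<in>V. (v - q) ^ (deg A v div 2))" for q
  have Q: "isCont Q m" "Q m \<noteq> 0"
    unfolding Q_def [abs_def] using isCont_edge_part[OF BE off] isCont_vertex_part[OF offv]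
    by (auto intro: isCont_divide)
  have lim: "((\<lambda>s. beside a b s) \<longlongrightarrow> m) (at_right 0)" "((\<lambda>s. beside a b (- s)) \<longlongrightarrow> m) (at_right 0)"
    unfolding m_def beside_def by (auto intro!: tendsto_eq_intros)
  have limQ: "((\<lambda>s. Q (beside a b (- s)) / Q (beside a b s)) \<longlongrightarrow> 1) (at_right 0)"
    using tendsto_divide[OF isCont_tendsto_compose[OF Q(1) lim(2)] isCont_tendsto_compose[OF Q(1) lim(1)] Q(2)] Q(2)
    by simp
  show ?thesis
  proof (cases "{a, b} \<in> A")
    case False
    then have "side_sign A = Q" by (auto simp: side_sign_def Q_def B_def)
    then show ?thesis using limQ False by simp
  next
    case True
    have fact: "side_sign A q = edge_root (tail {a, b}) (head {a, b}) q * Q q" for q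
      unfolding side_sign_def Q_def B_def prod.remove[OF fA True] by simp
    have "side_sign A (beside a b (- s)) / side_sign A (beside a b s)
        = - (Q (beside a b (- s)) / Q (beside a b s))" if "s > 0" for s
    proof -
      have "beside a b s \<noteq> a" "beside a b s \<noteq> b"
        using beside_ne_ends[OF edge_ne[OF ab]] by auto
      then have "edge_root (tail {a, b}) (head {a, b}) (beside a b s) \<noteq> 0"
        using ends[OF ab] by (intro edge_root_nonzero) auto
      then show ?thesis
        unfolding fact edge_root_ends_jump[OF ab less_imp_neq[OF that, symmetric]] by simp
    qed
    then have "\<forall>\<^sub>F s in at_right 0. - (Q (beside a b (- s)) / Q (beside a b s))
        = side_sign A (beside a b (- s)) / side_sign A (beside a b s)"
      by (auto intro!: eventually_at_rightI[of 0 1])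
    from Lim_transform_eventually[OF tendsto_minus[OF limQ] this] show ?thesis using True by simp
  qed
qed

end

section \<open>The face to the left of a directed edge\<close>

text \<open>The open isosceles triangle to the left of the segment from \<open>a\<close> to \<open>b\<close>, with base angles
  \<open>arctan h\<close>. It tapers towards both ends, so that for small \<open>h\<close> it also misses the other edges at
  \<open>a\<close> and \<open>b\<close>; a strip of constant width would not.\<close>

definition thin_triangle :: "complex \<Rightarrow> complex \<Rightarrow> real \<Rightarrow> complex set" where
  "thin_triangle a b h =
    (\<lambda>z. a + (b - a) * z) ` {z. 0 < Im z \<and> Im z < h * Re z \<and> Im z < h * (1 - Re z)}"

lemma connected_thin_triangle: "connected (thin_triangle a b h)"
proof -
  have "{z. 0 < Im z \<and> Im z < h * Re z \<and> Im z < h * (1 - Re z)} =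
    {z. inner \<i> z > 0} \<inter> {z. inner (Complex h (-1)) z > 0} \<inter> {z. inner (Complex (-h) (-1)) z > - h}"
    by (auto simp: inner_complex_def algebra_simps)
  also have "convex \<dots>" by (intro convex_Int convex_halfspace_gt)
  finally show ?thesis unfolding thin_triangle_def
    by (intro connected_continuous_image convex_connected continuous_intros)
qed

lemma beside_in_thin_triangle:
  assumes "0 < s" "2 * s < h" shows "beside a b s \<in> thin_triangle a b h"
  unfolding thin_triangle_def beside_def using assms by (intro imageI) simp

text \<open>An edge \<open>ac\<close> leaves \<open>a\<close> in the direction of \<open>w = (c - a)/(b - a)\<close>, measured relative to \<open>ab\<close>.
  It can enter the triangle only if \<open>0 < Im w < h * Re w\<close>, which fails for small \<open>h\<close>.\<close>

lemma thin_triangle_avoids_edge_at_end: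
  fixes a b c :: complex
  assumes "a \<noteq> b"
  shows "\<forall>\<^sub>F h in at_right 0. thin_triangle a b h \<inter> closed_segment a c = {}"
    "\<forall>\<^sub>F h in at_right 0. thin_triangle a b h \<inter> closed_segment b c = {}"
proof -
  have bound: "\<forall>\<^sub>F h in at_right (0::real). \<not> (0 < Im w \<and> Im w < h * norm w)" for w
  proof (cases "0 < Im w")
    case True
    then have "w \<noteq> 0" by auto
    then have "\<forall>\<^sub>F h in at_right 0. h < Im w / norm w"
      using True by (intro order_tendstoD(2)[of _ 0] tendsto_ident_at) auto
    then show ?thesis by eventually_elim (use \<open>w \<noteq> 0\<close> in \<open>simp add: field_simps\<close>)
  qed simp
  have pos: "\<forall>\<^sub>F h in at_right (0::real). 0 < h" by (simp add: eventually_at_right_less)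
  show "\<forall>\<^sub>F h in at_right 0. thin_triangle a b h \<inter> closed_segment a c = {}"
    using bound[of "(c - a) / (b - a)"] pos
  proof eventually_elim
    case (elim h)
    define w where "w = (c - a) / (b - a)"
    show ?case
    proof (rule ccontr)
      assume "\<not> ?thesis"
      then obtain z s where z: "0 < Im z" "Im z < h * Re z" and s: "0 \<le> s"
        and eq: "a + (b - a) * z = (1 - s) *\<^sub>R a + s *\<^sub>R c"
        by (auto simp: thin_triangle_def in_segment)
      have "(b - a) * w = c - a" using assms by (simp add: w_def)
      have "(b - a) * z = of_real s * (c - a)"
        using eq by (simp add: scaleR_conv_of_real algebra_simps)
      also have "\<dots> = (b - a) * (of_real s * w)"
        unfolding \<open>(b - a) * w = c - a\<close>[symmetric] by (simp add: algebra_simps)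
      finally have "(b - a) * z = (b - a) * (of_real s * w)" .
      then have zw: "z = of_real s * w" using assms by simp
      with z s have "0 < s" by (cases "s = 0") auto
      have "0 < s * Im w" "s * Im w < s * (h * Re w)"
        using z zw by (simp_all add: algebra_simps)
      with \<open>0 < s\<close> have "0 < Im w" "Im w < h * Re w"
        by (simp_all only: zero_less_mult_pos mult_less_cancel_left_pos)
      moreover have "h * Re w \<le> h * norm w" using elim(2) by (intro mult_left_mono complex_Re_le_cmod) auto
      ultimately show False using elim(1) by (simp add: w_def)
    qed
  qed
  show "\<forall>\<^sub>F h in at_right 0. thin_triangle a b h \<inter> closed_segment b c = {}"
    using bound[of "(c - b) / (b - a)"] pos
  proof eventually_elim
    case (elim h)
    define w where "w = (c - b) / (b - a)"
    show ?case
    proof (rule ccontr)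
      assume "\<not> ?thesis"
      then obtain z s where z: "0 < Im z" "Im z < h * (1 - Re z)" and s: "0 \<le> s"
        and eq: "a + (b - a) * z = (1 - s) *\<^sub>R b + s *\<^sub>R c"
        by (auto simp: thin_triangle_def in_segment)
      have "(b - a) * w = c - b" using assms by (simp add: w_def)
      have "(b - a) * z = (b - a) + of_real s * (c - b)"
        using eq by (simp add: scaleR_conv_of_real algebra_simps)
      also have "\<dots> = (b - a) * (1 + of_real s * w)"
        unfolding \<open>(b - a) * w = c - b\<close>[symmetric] by (simp add: algebra_simps)
      finally have zw: "z = 1 + of_real s * w" using assms by simp
      with z s have "0 < s" by (cases "s = 0") auto
      have "0 < s * Im w" "s * Im w < s * (h * (- Re w))"
        using z zw by (simp_all add: algebra_simps)
      with \<open>0 < s\<close> have "0 < Im w" "Im w < h * (- Re w)"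
        by (simp_all only: zero_less_mult_pos mult_less_cancel_left_pos)
      moreover have "h * (- Re w) \<le> h * norm w"
        using elim(2) abs_Re_le_cmod[of w] by (intro mult_left_mono) auto
      ultimately show False using elim(1) by (simp add: w_def)
    qed
  qed
qed

lemma thin_triangle_avoids_disjoint:
  assumes "compact K" "closed_segment a b \<inter> K = {}" "a \<noteq> b"
  shows "\<forall>\<^sub>F h in at_right 0. thin_triangle a b h \<inter> K = {}"
proof -
  obtain d where d: "d > 0" "\<And>x y. x \<in> closed_segment a b \<Longrightarrow> y \<in> K \<Longrightarrow> d \<le> dist x y"
    using separate_compact_closed[OF compact_segment compact_imp_closed[OF assms(1)] assms(2)] by blast
  have "\<forall>\<^sub>F h in at_right 0. h < d / norm (b - a)"
    using d assms(3) by (intro order_tendstoD(2)[of _ 0] tendsto_ident_at) auto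
  moreover have "\<forall>\<^sub>F h in at_right (0::real). 0 < h" by (simp add: eventually_at_right_less)
  ultimately show ?thesis
  proof eventually_elim
    case (elim h)
    have h: "norm (b - a) * h < d" using elim assms(3) by (simp add: field_simps)
    show ?case
    proof (rule ccontr)
      assume "\<not> ?thesis"
      then obtain z where z: "0 < Im z" "Im z < h * Re z" "Im z < h * (1 - Re z)"
        and K: "a + (b - a) * z \<in> K" by (auto simp: thin_triangle_def)
      have Re: "0 < h * Re z" "0 < h * (1 - Re z)" using z by linarith+
      then have Re: "0 < Re z" "Re z < 1" using elim(2) by (auto simp: zero_less_mult_iff)
      then have "h * (1 - Re z) \<le> h" using elim(2) by (simp add: algebra_simps)
      with z have "Im z < h" by linarith
      have "a + (b - a) * of_real (Re z) \<in> closed_segment a b"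
        unfolding in_segment using Re
        by (intro exI[of _ "Re z"]) (auto simp: scaleR_conv_of_real algebra_simps)
      from d(2)[OF this K] have "d \<le> norm ((b - a) * (of_real (Re z) - z))"
        by (simp add: dist_norm algebra_simps)
      also have "\<dots> = norm (b - a) * norm (of_real (Re z) - z)" by (rule norm_mult)
      also have "norm (of_real (Re z) - z) = Im z" using z(1) by (simp add: cmod_def)
      also have "norm (b - a) * Im z \<le> norm (b - a) * h" using \<open>Im z < h\<close> by (intro mult_left_mono) auto
      finally show False using h by simp
    qed
  qed
qed

text \<open>Between an angle and its cyclic successor among the angles of a list in \<open>[0, 2\<pi>)\<close> there is no
  angle congruent to one of the list; the last angle is succeeded by the first one, raised by \<open>2\<pi>\<close>.\<close>

lemma no_direction_between:
  assumes "strict_mono_on {..<n} \<theta>" and range: "\<And>i. i < n \<Longrightarrow> 0 \<le> \<theta> i \<and> \<theta> i < 2 * pi"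
    and m: "m < n" and j: "j < n"
    and \<psi>: "\<theta> m < \<psi>" "\<psi> < (if Suc m < n then \<theta> (Suc m) else \<theta> 0 + 2 * pi)"
    and k: "\<psi> = \<theta> j + 2 * pi * real_of_int k"
  shows False
proof -
  have mono: "i < i' \<Longrightarrow> i' < n \<Longrightarrow> \<theta> i < \<theta> i'" for i i'
    using assms(1) by (auto simp: strict_mono_on_def)
  have mono': "i \<le> i' \<Longrightarrow> i' < n \<Longrightarrow> \<theta> i \<le> \<theta> i'" for i i'
    using mono[of i i'] by (cases "i = i'") auto
  consider "k \<le> - 1" | "k = 0" | "k \<ge> 1" by linarith
  then show False
  proof cases
    case 1
    then have "2 * pi * real_of_int k \<le> 2 * pi * (- 1)" by (intro mult_left_mono) auto
    then show False using range[OF m] range[OF j] \<psi>(1) k by linarith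
  next
    case 2
    then have "\<theta> m < \<theta> j" using \<psi>(1) k by simp
    then have "m < j" using mono'[of j m] m by (meson not_less order_le_less_trans linorder_not_le)
    then show False using mono'[of "Suc m" j] j \<psi>(2) k 2 by simp
  next
    case 3
    then have "2 * pi * 1 \<le> 2 * pi * real_of_int k" by (intro mult_left_mono) auto
    then have "\<theta> 0 + 2 * pi \<le> \<psi>" using mono'[OF le0 j] k by linarith
    then show False using \<psi>(2) range[of "Suc m"] range[of 0] m by (auto split: if_splits)
  qed
qed

context straight_line_graph
begin

lemma finite_edge: "e \<in> E \<Longrightarrow> finite e"
  using card_edge by (metis card.infinite zero_neq_numeral)

lemma thin_triangle_avoids_drawing:
  assumes ab: "{a, b} \<in> E"
  shows "\<forall>\<^sub>F h in at_right 0. thin_triangle a b h \<inter> drawing = {}"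
proof -
  have ne: "a \<noteq> b" by (rule edge_ne[OF ab])
  have "\<forall>\<^sub>F h in at_right 0. thin_triangle a b h \<inter> convex hull e = {}" if e: "e \<in> E" for e
  proof -
    obtain c d where cd: "e = {c, d}" using edge_cases[OF e] by metis
    consider "a \<in> e" | "b \<in> e" | "a \<notin> e" "b \<notin> e" by blast
    then show ?thesis
    proof cases
      case 1
      then obtain c where "e = {a, c}" using cd by blast
      then show ?thesis using thin_triangle_avoids_edge_at_end(1)[OF ne, of c]
        by (simp add: segment_convex_hull)
    next
      case 2
      then obtain c where "e = {b, c}" using cd by blast
      then show ?thesis using thin_triangle_avoids_edge_at_end(2)[OF ne, of c]
        by (simp add: segment_convex_hull)
    next
      case 3
      then have "closed_segment a b \<inter> convex hull e = {}"
        using edges_meet[OF ab e] by (auto simp: segment_convex_hull)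
      then show ?thesis
        using ne e by (intro thin_triangle_avoids_disjoint finite_imp_compact_convex_hull finite_edge)
    qed
  qed
  then have "\<forall>\<^sub>F h in at_right 0. \<forall>e\<in>E. thin_triangle a b h \<inter> convex hull e = {}"
    using finite_E by (simp add: eventually_ball_finite)
  then show ?thesis by eventually_elim (auto simp: drawing_def)
qed

text \<open>For small \<open>h\<close> the thin triangle avoids the drawing and lies in one component; any two thin
  triangles on the same side overlap, so the component is unique.\<close>

definition left_face :: "complex \<Rightarrow> complex \<Rightarrow> complex set" where
  "left_face a b = (THE C. C \<in> components (- drawing) \<and> (\<exists>h>0. thin_triangle a b h \<subseteq> C))"

lemma left_face_eqI:
  assumes "C \<in> components (- drawing)" "h > 0" "thin_triangle a b h \<subseteq> C"
  shows "left_face a b = C"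
  unfolding left_face_def
proof (rule the_equality)
  fix D assume D: "D \<in> components (- drawing) \<and> (\<exists>h>0. thin_triangle a b h \<subseteq> D)"
  then obtain k where k: "k > 0" "thin_triangle a b k \<subseteq> D" by blast
  have "beside a b (min h k / 4) \<in> thin_triangle a b h \<inter> thin_triangle a b k"
    using assms(2) k(1) by (auto intro!: beside_in_thin_triangle)
  then have "C \<inter> D \<noteq> {}" using assms(3) k(2) by blast
  then show "D = C" using components_eq[OF assms(1)] D by blast
qed (use assms in blast)

lemma left_face:
  assumes "{a, b} \<in> E"
  obtains h where "h > 0" "thin_triangle a b h \<subseteq> left_face a b" "left_face a b \<in> components (- drawing)"
proof -
  have "\<forall>\<^sub>F h in at_right 0. thin_triangle a b h \<inter> drawing = {} \<and> 0 < h"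
    using thin_triangle_avoids_drawing[OF assms] by (simp add: eventually_conj eventually_at_right_less)
  then obtain h where h: "thin_triangle a b h \<inter> drawing = {}" "h > 0"
    using eventually_happens'[OF trivial_limit_at_right_real] by blast
  have "beside a b (h / 4) \<in> thin_triangle a b h" using h(2) by (intro beside_in_thin_triangle) auto
  then have "- drawing \<noteq> {}" using h(1) by blast
  then obtain C where C: "C \<in> components (- drawing)" "thin_triangle a b h \<subseteq> C"
    using exists_component_superset[of "thin_triangle a b h" "- drawing"] connected_thin_triangle h(1) by blast
  with left_face_eqI[OF C(1) h(2) C(2)] h(2) show ?thesis using that by simp
qed

lemma eventually_beside_in_left_face:
  assumes "{a, b} \<in> E"
  shows "\<forall>\<^sub>F s in at_right 0. beside a b s \<in> left_face a b"
proof -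
  obtain h where h: "h > 0" "thin_triangle a b h \<subseteq> left_face a b" using left_face[OF assms] by metis
  show ?thesis
    by (rule eventually_at_rightI[of 0 "h / 2"]) (use h beside_in_thin_triangle[of _ h a b] in auto)
qed

lemma left_face_eq_of_connected:
  assumes "{a, b} \<in> E" "{c, d} \<in> E" "connected S" "S \<inter> drawing = {}"
    and "\<And>h. h > 0 \<Longrightarrow> S \<inter> thin_triangle a b h \<noteq> {}" "\<And>h. h > 0 \<Longrightarrow> S \<inter> thin_triangle c d h \<noteq> {}"
  shows "left_face a b = left_face c d"
proof -
  obtain h where h: "h > 0" "thin_triangle a b h \<subseteq> left_face a b" "left_face a b \<in> components (- drawing)"
    using left_face[OF assms(1)] .
  obtain k where k: "k > 0" "thin_triangle c d k \<subseteq> left_face c d" "left_face c d \<in> components (- drawing)"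
    using left_face[OF assms(2)] .
  have "left_face a b \<inter> S \<noteq> {}" "left_face c d \<inter> S \<noteq> {}" using assms(5)[OF h(1)] assms(6)[OF k(1)] h(2) k(2) by blast+
  then have "S \<subseteq> left_face a b" "S \<subseteq> left_face c d"
    using components_maximal[OF h(3) assms(3)] components_maximal[OF k(3) assms(3)] assms(4) by blast+
  moreover have "S \<noteq> {}" using assms(5)[OF h(1)] by blast
  ultimately have "left_face a b \<inter> left_face c d \<noteq> {}" by blast
  then show ?thesis using components_eq[OF h(3) k(3)] by blast
qed

text \<open>Coming from \<open>u\<close> to \<open>v\<close>, the left-hand side of the edge is the clockwise side of the ray from \<open>v\<close>
  to \<open>u\<close>. If no edge leaves \<open>v\<close> between the directions \<open>\<theta>\<close> of \<open>w\<close> and \<open>\<phi>\<close> of \<open>u\<close>, a small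
  circular arc around \<open>v\<close> connects the two thin triangles. The angles may differ by up to \<open>2\<pi>\<close>, which
  covers reflex corners and vertices with only one edge.\<close>

lemma left_face_turn:
  assumes vu: "{v, u} \<in> E" and vw: "{v, w} \<in> E"
    and u: "u - v = of_real (norm (u - v)) * cis \<phi>" and w: "w - v = of_real (norm (w - v)) * cis \<theta>"
    and less: "\<theta> < \<phi>"
    and free: "\<And>x \<psi>. {v, x} \<in> E \<Longrightarrow> \<theta> < \<psi> \<Longrightarrow> \<psi> < \<phi> \<Longrightarrow> x - v \<noteq> of_real (norm (x - v)) * cis \<psi>"
  shows "left_face u v = left_face v w"
proof -
  have "\<forall>\<^sub>F r in at_right 0. \<forall>y\<in>convex hull e. r < dist v y" if e: "e \<in> E" "v \<notin> e" for e
  proof -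
    have "v \<notin> convex hull e"
    proof
      assume "v \<in> convex hull e"
      then have "v \<in> {v, u} \<inter> e"
        using edges_meet[OF vu e(1)] e hull_inc[of v "{v, u}"] by blast
      with e show False by blast
    qed
    moreover have "closed (convex hull e)"
      using e by (intro compact_imp_closed finite_imp_compact_convex_hull finite_edge)
    ultimately have "\<exists>d>0. \<forall>y\<in>convex hull e. d \<le> dist v y" by (intro separate_point_closed)
    then obtain d where d: "d > 0" "\<And>y. y \<in> convex hull e \<Longrightarrow> d \<le> dist v y" by metis
    show ?thesis
      by (rule eventually_at_rightI[of 0 d]) (use d in force)+
  qed
  then have "\<forall>\<^sub>F r in at_right 0. \<forall>e\<in>{e \<in> E. v \<notin> e}. \<forall>y\<in>convex hull e. r < dist v y"
    using finite_E by (intro eventually_ball_finite) auto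
  moreover have "\<forall>\<^sub>F r in at_right 0. 0 < r \<and> r < norm (u - v) \<and> r < norm (w - v)"
    using edge_ne[OF vu] edge_ne[OF vw]
    by (intro eventually_at_rightI[of 0 "min (norm (u - v)) (norm (w - v))"]) auto
  ultimately have "\<forall>\<^sub>F r in at_right 0. (\<forall>e\<in>{e \<in> E. v \<notin> e}. \<forall>y\<in>convex hull e. r < dist v y) \<and>
      0 < r \<and> r < norm (u - v) \<and> r < norm (w - v)"
    by (rule eventually_conj)
  then obtain r where far: "\<And>e y. e \<in> E \<Longrightarrow> v \<notin> e \<Longrightarrow> y \<in> convex hull e \<Longrightarrow> r < dist v y"
    and r: "0 < r" "r < norm (u - v)" "r < norm (w - v)"
    using eventually_happens'[OF trivial_limit_at_right_real] by blast
  define arc where "arc = (\<lambda>\<psi>. v + of_real r * cis \<psi>) ` {\<theta><..<\<phi>}"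
  have conn: "connected arc" unfolding arc_def
    by (intro connected_continuous_image continuous_intros) auto
  have avoid: "arc \<inter> drawing = {}"
  proof (rule ccontr)
    assume "arc \<inter> drawing \<noteq> {}"
    then obtain e \<psi> where e: "e \<in> E" and \<psi>: "\<theta> < \<psi>" "\<psi> < \<phi>"
      and y: "v + of_real r * cis \<psi> \<in> convex hull e"
      by (auto simp: arc_def drawing_def)
    have "v \<in> e"
    proof (rule ccontr)
      assume "v \<notin> e"
      from far[OF e this y] show False using r by (simp add: dist_norm norm_mult)
    qed
    then obtain x where x: "e = {v, x}" using edge_cases[OF e] by blast
    then have "v + of_real r * cis \<psi> \<in> closed_segment v x" using y by (simp add: segment_convex_hull)
    then obtain s where s: "0 \<le> s" "v + of_real r * cis \<psi> = (1 - s) *\<^sub>R v + s *\<^sub>R x"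
      by (auto simp: in_segment)
    then have eq: "of_real r * cis \<psi> = of_real s * (x - v)"
      by (simp add: scaleR_conv_of_real algebra_simps)
    have "s \<noteq> 0" using eq r by auto
    then have xv: "x - v = of_real (r / s) * cis \<psi>" using eq by (simp add: field_simps)
    moreover have "norm (x - v) = r / s" unfolding xv using s r by (simp add: norm_mult norm_divide)
    ultimately show False using free[of x \<psi>] e x \<psi> by simp
  qed
  \<comment> \<open>the end of the arc at angular distance \<open>\<eta>\<close> from an edge lies in its thin triangle once \<open>\<eta>\<close> is small\<close>
  have small: "\<exists>\<eta>. 0 < \<eta> \<and> \<eta> < \<phi> - \<theta> \<and> 0 < t * sin \<eta> \<and> t * sin \<eta> < h * (t * cos \<eta>) \<and> t * sin \<eta> < h * (1 - t * cos \<eta>)"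
    if "0 < t" "t < 1" "0 < h" for t h
  proof -
    have lim1: "((\<lambda>\<eta>. h * (t * cos \<eta>) - t * sin \<eta>) \<longlongrightarrow> h * t) (at_right 0)"
      by (auto intro!: tendsto_eq_intros)
    have lim2: "((\<lambda>\<eta>. h * (1 - t * cos \<eta>) - t * sin \<eta>) \<longlongrightarrow> h * (1 - t)) (at_right 0)"
      by (auto intro!: tendsto_eq_intros)
    have "\<forall>\<^sub>F \<eta> in at_right 0. 0 < h * (t * cos \<eta>) - t * sin \<eta>"
      "\<forall>\<^sub>F \<eta> in at_right 0. 0 < h * (1 - t * cos \<eta>) - t * sin \<eta>"
      using that by (intro order_tendstoD(1)[OF lim1] order_tendstoD(1)[OF lim2]; simp)+
    moreover have "\<forall>\<^sub>F \<eta> in at_right 0. 0 < \<eta> \<and> \<eta> < \<phi> - \<theta> \<and> \<eta> < pi"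
      using less by (intro eventually_at_rightI[of 0 "min (\<phi> - \<theta>) pi"]) auto
    ultimately have "\<forall>\<^sub>F \<eta> in at_right 0. 0 < \<eta> \<and> \<eta> < \<phi> - \<theta> \<and> 0 < t * sin \<eta> \<and>
        t * sin \<eta> < h * (t * cos \<eta>) \<and> t * sin \<eta> < h * (1 - t * cos \<eta>)"
      by eventually_elim (use that sin_gt_zero in auto)
    then show ?thesis using eventually_happens'[OF trivial_limit_at_right_real] by blast
  qed
  show ?thesis
  proof (rule left_face_eq_of_connected[OF _ vw conn avoid])
    show "{u, v} \<in> E" using vu by (simp add: insert_commute)
    fix h :: real assume h: "h > 0"
    show "arc \<inter> thin_triangle u v h \<noteq> {}"
    proof -
      define t where "t = r / norm (u - v)"
      have "0 < norm (u - v)" using r by linarith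
      then have t: "0 < t" "t < 1" using r by (simp_all add: t_def)
      obtain \<eta> where \<eta>: "0 < \<eta>" "\<eta> < \<phi> - \<theta>" "0 < t * sin \<eta>" "t * sin \<eta> < h * (t * cos \<eta>)"
        "t * sin \<eta> < h * (1 - t * cos \<eta>)"
        using small[OF t h] by blast
      have tn: "of_real t * of_real (norm (u - v)) = complex_of_real r"
        unfolding of_real_mult[symmetric] using edge_ne[OF vu] by (simp add: t_def)
      have "of_real t * cis (- \<eta>) * (u - v) = of_real r * cis (\<phi> - \<eta>)"
        by (subst u) (simp add: tn[symmetric] cis_mult algebra_simps)
      then have "v + of_real r * cis (\<phi> - \<eta>) = u + (v - u) * (1 - of_real t * cis (- \<eta>))"
        by (simp add: algebra_simps)
      moreover have "v + of_real r * cis (\<phi> - \<eta>) \<in> arc" unfolding arc_def using \<eta> by auto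
      moreover have "u + (v - u) * (1 - of_real t * cis (- \<eta>)) \<in> thin_triangle u v h"
        unfolding thin_triangle_def using \<eta> by (intro imageI) simp
      ultimately show ?thesis by auto
    qed
    show "arc \<inter> thin_triangle v w h \<noteq> {}"
    proof -
      define t where "t = r / norm (w - v)"
      have "0 < norm (w - v)" using r by linarith
      then have t: "0 < t" "t < 1" using r by (simp_all add: t_def)
      obtain \<eta> where \<eta>: "0 < \<eta>" "\<eta> < \<phi> - \<theta>" "0 < t * sin \<eta>" "t * sin \<eta> < h * (t * cos \<eta>)"
        "t * sin \<eta> < h * (1 - t * cos \<eta>)"
        using small[OF t h] by blast
      have tn: "of_real t * of_real (norm (w - v)) = complex_of_real r"
        unfolding of_real_mult[symmetric] using edge_ne[OF vw] by (simp add: t_def)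
      have "(w - v) * (of_real t * cis \<eta>) = of_real r * cis (\<theta> + \<eta>)"
        by (subst w) (simp add: tn[symmetric] cis_mult algebra_simps)
      then have "v + of_real r * cis (\<theta> + \<eta>) = v + (w - v) * (of_real t * cis \<eta>)" by simp
      moreover have "v + of_real r * cis (\<theta> + \<eta>) \<in> arc" unfolding arc_def using \<eta> by auto
      moreover have "v + (w - v) * (of_real t * cis \<eta>) \<in> thin_triangle v w h"
        unfolding thin_triangle_def using \<eta> by (intro imageI) simp
      ultimately show ?thesis by auto
    qed
  qed
qed

section \<open>The cyclic order around a vertex\<close>

definition nbrs :: "complex \<Rightarrow> complex set" where "nbrs v = {u. {v, u} \<in> E}"

lemma nbrs_subset: "nbrs v \<subseteq> V"
  using edge_subset by (auto simp: nbrs_def)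

lemma inj_on_direction: "inj_on (\<lambda>u. Arg2pi (u - v)) (nbrs v)"
proof (rule inj_onI)
  have *: "x = y" if "{v, x} \<in> E" "{v, y} \<in> E" "Arg2pi (x - v) = Arg2pi (y - v)" "norm (x - v) \<le> norm (y - v)" for x y
  proof (rule ccontr)
    assume "x \<noteq> y"
    define t where "t = norm (x - v) / norm (y - v)"
    have t: "0 \<le> t" "t \<le> 1" "norm (x - v) = t * norm (y - v)"
      using that(4) edge_ne[OF that(2)] by (auto simp: t_def divide_le_eq_1)
    have "x - v = of_real (norm (x - v)) * exp (\<i> * of_real (Arg2pi (x - v)))" by (rule Arg2pi_eq)
    also have "\<dots> = of_real t * (of_real (norm (y - v)) * exp (\<i> * of_real (Arg2pi (y - v))))"
      unfolding t(3) that(3) by simp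
    also have "\<dots> = of_real t * (y - v)" by (simp flip: Arg2pi_eq)
    finally have "x = (1 - t) *\<^sub>R v + t *\<^sub>R y" by (simp add: scaleR_conv_of_real algebra_simps)
    then have "x \<in> convex hull {v, y}"
      using t unfolding segment_convex_hull[symmetric] in_segment by blast
    moreover have "x \<in> convex hull {v, x}" by (intro hull_inc) auto
    ultimately have "x \<in> {v, y}" using edges_meet[OF that(1,2)] \<open>x \<noteq> y\<close> by (auto simp: doubleton_eq_iff)
    then show False using \<open>x \<noteq> y\<close> edge_ne[OF that(1)] by auto
  qed
  fix x y assume "x \<in> nbrs v" "y \<in> nbrs v" "Arg2pi (x - v) = Arg2pi (y - v)"
  then show "x = y"
    using *[of x y] *[of y x] by (cases "norm (x - v) \<le> norm (y - v)") (auto simp: nbrs_def)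
qed

text \<open>The enumeration \<open>p\<close> lists the neighbours counterclockwise; it is periodic, so that its last
  neighbour is followed by the first one.\<close>

lemma rotation_at_vertex:
  assumes "nbrs v \<noteq> {}"
  obtains p where "bij_betw p {..<card (nbrs v)} (nbrs v)" "\<And>i. p (i + card (nbrs v)) = p i"
    "\<And>i. left_face (p (Suc i)) v = left_face v (p i)"
proof -
  define N n where "N = nbrs v" and "n = card (nbrs v)"
  have fin: "finite N" unfolding N_def using nbrs_subset finite_V by (rule finite_subset)
  have n: "n > 0" using fin assms by (simp add: N_def n_def card_gt_0_iff)
  define ang where "ang u = Arg2pi (u - v)" for u
  have inj: "inj_on ang N" unfolding N_def ang_def by (rule inj_on_direction)
  define L where "L = sorted_list_of_set (ang ` N)"
  have L: "set L = ang ` N" "length L = n" "sorted_wrt (<) L"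
    using fin inj by (simp_all add: L_def N_def n_def card_image)
  define \<theta> where "\<theta> i = L ! i" for i
  have mono: "strict_mono_on {..<n} \<theta>"
    unfolding strict_mono_on_def \<theta>_def using L(2,3) by (auto simp: sorted_wrt_iff_nth_less)
  have bij\<theta>: "bij_betw \<theta> {..<n} (ang ` N)"
    unfolding \<theta>_def using bij_betw_nth[of L "{..<n}" "ang ` N"] L strict_sorted_iff by auto
  have range: "0 \<le> \<theta> i \<and> \<theta> i < 2 * pi" if "i < n" for i
  proof -
    have "\<theta> i \<in> ang ` N" using bij_betwE[OF bij\<theta>] that by auto
    then show ?thesis using Arg2pi by (auto simp: ang_def)
  qed
  define p where "p i = inv_into N ang (\<theta> (i mod n))" for i
  have p: "p i \<in> N" "ang (p i) = \<theta> (i mod n)" for i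
  proof -
    have "\<theta> (i mod n) \<in> ang ` N" using bij_betwE[OF bij\<theta>] n by auto
    then show "p i \<in> N" "ang (p i) = \<theta> (i mod n)"
      unfolding p_def by (auto intro: inv_into_into f_inv_into_f)
  qed
  have bij: "bij_betw p {..<n} N"
  proof -
    have "bij_betw (inv_into N ang \<circ> \<theta>) {..<n} N"
      by (rule bij_betw_trans[OF bij\<theta>]) (rule bij_betw_inv_into[OF inj_on_imp_bij_betw[OF inj]])
    then show ?thesis by (rule bij_betw_cong[THEN iffD1, rotated]) (simp add: p_def)
  qed
  have polar: "u - v = of_real (norm (u - v)) * cis (ang u)" for u
    unfolding ang_def cis_conv_exp by (rule Arg2pi_eq)
  have turn: "left_face (p (Suc i)) v = left_face v (p i)" for i
  proof -
    define m where "m = i mod n"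
    define \<phi> where "\<phi> = (if Suc m < n then \<theta> (Suc m) else \<theta> 0 + 2 * pi)"
    have m: "m < n" using n by (simp add: m_def)
    show ?thesis
    proof (rule left_face_turn)
      show "{v, p (Suc i)} \<in> E" "{v, p i} \<in> E" using p(1) by (auto simp: N_def nbrs_def)
      have Suc: "Suc i mod n = (if Suc m < n then Suc m else 0)"
        using m by (auto simp: m_def mod_Suc)
      have "cis (ang (p (Suc i))) = cis \<phi>"
        unfolding p(2) Suc \<phi>_def by (auto simp: complex_eq_iff)
      then show "p (Suc i) - v = of_real (norm (p (Suc i) - v)) * cis \<phi>" using polar by metis
      show "p i - v = of_real (norm (p i - v)) * cis (\<theta> m)" using polar[of "p i"] p(2) by (simp add: m_def)
      show "\<theta> m < \<phi>"
        using mono m range[of m] range[of 0] n by (auto simp: \<phi>_def strict_mono_on_def)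
      fix x \<psi> assume x: "{v, x} \<in> E" and \<psi>: "\<theta> m < \<psi>" "\<psi> < \<phi>"
      show "x - v \<noteq> of_real (norm (x - v)) * cis \<psi>"
      proof
        assume "x - v = of_real (norm (x - v)) * cis \<psi>"
        with polar[of x] have "of_real (norm (x - v)) * cis \<psi> = of_real (norm (x - v)) * cis (ang x)" by simp
        then have "cis \<psi> = cis (ang x)" using edge_ne[OF x] by simp
        then obtain k where k: "\<psi> = ang x + 2 * pi * real_of_int k"
          unfolding cis_conv_exp exp_eq by (auto simp: complex_eq_iff)
        have "ang x \<in> ang ` N" using x by (auto simp: N_def nbrs_def)
        then obtain j where "j < n" "ang x = \<theta> j" using bij\<theta> by (auto simp: bij_betw_def)
        then show False using no_direction_between[OF mono range m _ \<psi>(1)] \<psi>(2) k by (auto simp: \<phi>_def)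
      qed
    qed
  qed
  show ?thesis by (rule that[of p]) (use bij turn in \<open>auto simp: N_def n_def p_def\<close>)
qed

end

section \<open>There are more faces than edges minus vertices\<close>

lemma even_card_symmetric_difference:
  assumes "finite X" "finite Y"
  shows "even (card ((X - Y) \<union> (Y - X))) \<longleftrightarrow> (even (card X) \<longleftrightarrow> even (card Y))"
proof -
  have "card ((X - Y) \<union> (Y - X)) = card (X - Y) + card (Y - X)"
    using assms by (intro card_Un_disjoint) auto
  moreover have "card X = card (X \<inter> Y) + card (X - Y)" "card Y = card (X \<inter> Y) + card (Y - X)"
    using card_Int_Diff[OF assms(1), of Y] card_Int_Diff[OF assms(2), of X] by (simp_all add: Int_commute)
  ultimately show ?thesis by presburger
qed

context straight_line_graph
begin

definition odd_vertices :: "complex set set \<Rightarrow> complex set" where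
  "odd_vertices A = {v \<in> V. odd (deg A v)}"

definition even_subgraphs :: "complex set set set" where
  "even_subgraphs = {A. A \<subseteq> E \<and> odd_vertices A = {}}"

definition faces :: "complex set set" where
  "faces = {left_face a b | a b. {a, b} \<in> E}"

lemma sum_deg:
  assumes "A \<subseteq> E" shows "(\<Sum>v\<in>V. deg A v) = 2 * card A"
proof -
  have fA: "finite A" using assms finite_E finite_subset by blast
  have "(\<Sum>v\<in>V. deg A v) = (\<Sum>v\<in>V. \<Sum>e | e \<in> A \<and> v \<in> e. 1)" by (simp add: deg_def)
  also have "\<dots> = (\<Sum>e\<in>A. \<Sum>v | v \<in> V \<and> v \<in> e. 1)" by (rule sum.swap_restrict[OF finite_V fA])
  also have "\<dots> = (\<Sum>e\<in>A. card e)"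
  proof (intro sum.cong refl)
    fix e assume "e \<in> A"
    then have "{v. v \<in> V \<and> v \<in> e} = e" using assms edge_subset by blast
    then show "(\<Sum>v | v \<in> V \<and> v \<in> e. 1) = card e" by simp
  qed
  also have "\<dots> = (\<Sum>e\<in>A. 2)" by (intro sum.cong refl) (use assms card_edge in auto)
  finally show ?thesis by simp
qed

lemma even_card_odd_vertices:
  assumes "A \<subseteq> E" shows "even (card (odd_vertices A))"
  using even_sum_iff[OF finite_V, of "deg A"] sum_deg[OF assms] by (simp add: odd_vertices_def)

lemma odd_vertices_symmetric_difference:
  assumes "A \<subseteq> E" "B \<subseteq> E" "odd_vertices A = odd_vertices B"
  shows "(A - B) \<union> (B - A) \<in> even_subgraphs"
proof -
  have fin: "finite A" "finite B" using assms finite_E finite_subset by blast+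
  have "even (deg ((A - B) \<union> (B - A)) v)" if "v \<in> V" for v
  proof -
    have "{e \<in> (A - B) \<union> (B - A). v \<in> e} =
        ({e \<in> A. v \<in> e} - {e \<in> B. v \<in> e}) \<union> ({e \<in> B. v \<in> e} - {e \<in> A. v \<in> e})" by blast
    moreover have "even (deg A v) \<longleftrightarrow> even (deg B v)"
      using assms(3) that unfolding odd_vertices_def by blast
    ultimately show ?thesis
      using even_card_symmetric_difference[of "{e \<in> A. v \<in> e}" "{e \<in> B. v \<in> e}"] fin
      by (simp add: deg_def)
  qed
  then show ?thesis using assms(1,2) by (auto simp: even_subgraphs_def odd_vertices_def)
qed

text \<open>The map \<^const>\<open>odd_vertices\<close> sends the \<open>2 ^ card E\<close> edge sets to sets of vertices. Its fibres are
  no larger than the set of even subgraphs, by symmetric difference with a fixed member of the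
  fibre. Its image is a proper subset of the power set of \<open>V\<close>, since the number of
  odd vertices is even; this makes the inequality strict.\<close>

lemma many_even_subgraphs:
  assumes "V \<noteq> {}"
  shows "2 ^ card E < card even_subgraphs * 2 ^ card V"
proof -
  define I where "I = odd_vertices ` Pow E"
  have fE: "finite (Pow E)" using finite_E by simp
  have finZ: "finite even_subgraphs" by (rule finite_subset[OF _ fE]) (auto simp: even_subgraphs_def)
  have "{} \<in> even_subgraphs" by (simp add: even_subgraphs_def odd_vertices_def deg_def)
  then have Z: "0 < card even_subgraphs" using finZ card_gt_0_iff by blast
  have fibre: "card {A \<in> Pow E. odd_vertices A = y} \<le> card even_subgraphs" for y
  proof (cases "\<exists>B\<subseteq>E. odd_vertices B = y")
    case False
    then have "{A \<in> Pow E. odd_vertices A = y} = {}" by blast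
    then show ?thesis by (simp only: card.empty le0)
  next
    case True
    then obtain B where B: "B \<subseteq> E" "odd_vertices B = y" by blast
    show ?thesis
    proof (rule card_inj_on_le[OF _ _ finZ])
      show "inj_on (\<lambda>A. (A - B) \<union> (B - A)) {A \<in> Pow E. odd_vertices A = y}"
        by (rule inj_onI) blast
      show "(\<lambda>A. (A - B) \<union> (B - A)) ` {A \<in> Pow E. odd_vertices A = y} \<subseteq> even_subgraphs"
        using odd_vertices_symmetric_difference[OF _ B(1)] B(2) by auto
    qed
  qed
  have finI: "finite I" unfolding I_def using fE by (rule finite_imageI)
  have "2 ^ card E = card (\<Union>y\<in>I. {A \<in> Pow E. odd_vertices A = y})"
  proof -
    have "(\<Union>y\<in>I. {A \<in> Pow E. odd_vertices A = y}) = Pow E" by (auto simp: I_def)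
    then show ?thesis using finite_E by (simp add: card_Pow)
  qed
  also have "\<dots> \<le> (\<Sum>y\<in>I. card {A \<in> Pow E. odd_vertices A = y})" by (rule card_UN_le[OF finI])
  also have "\<dots> \<le> card I * card even_subgraphs" using sum_bounded_above[of I, OF fibre] by simp
  also have "card I < 2 ^ card V"
  proof -
    obtain v where v: "v \<in> V" using assms by blast
    have "{v} \<notin> I"
    proof
      assume "{v} \<in> I"
      then obtain A where "A \<subseteq> E" "odd_vertices A = {v}" unfolding I_def by blast
      then show False using even_card_odd_vertices[of A] by simp
    qed
    then have "I \<subset> Pow V" using v by (auto simp: I_def odd_vertices_def)
    then show ?thesis using psubset_card_mono[of "Pow V" I] finite_V by (simp add: card_Pow)
  qed
  then have "card I * card even_subgraphs < 2 ^ card V * card even_subgraphs" using Z by simp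
  finally show ?thesis by (simp add: mult.commute)
qed

lemma finite_faces: "finite faces"
proof -
  have "faces \<subseteq> (\<lambda>(a, b). left_face a b) ` (V \<times> V)"
    using edge_subset by (fastforce simp: faces_def)
  then show ?thesis using finite_V finite_subset by blast
qed

lemma side_sign_on_face:
  assumes A: "A \<in> even_subgraphs" and C: "C \<in> components (- drawing)"
  shows "(\<forall>q\<in>C. side_sign A q = 1) \<or> (\<forall>q\<in>C. side_sign A q = - 1)"
proof -
  have AE: "A \<subseteq> E" using A by (simp add: even_subgraphs_def)
  have off: "q \<notin> convex hull e" if "q \<in> C" "e \<in> A" for q e
    using that in_components_subset[OF C] AE by (auto simp: drawing_def)
  have val: "side_sign A q = 1 \<or> side_sign A q = - 1" if "q \<in> C" for q
  proof -
    have "even (deg A v)" if "v \<in> V" for v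
      using A that unfolding even_subgraphs_def odd_vertices_def by blast
    then have "(side_sign A q)\<^sup>2 = 1"
      using off[OF that] hull_inc by (intro side_sign_square[OF AE]) fastforce+
    then show ?thesis by (simp add: power2_eq_1_iff)
  qed
  have "continuous_on C (side_sign A)"
    using isCont_side_sign[OF AE off] by (intro continuous_at_imp_continuous_on) blast
  moreover have "finite (side_sign A ` C)"
    by (rule finite_subset[of _ "{1, - 1}"]) (use val in auto)
  ultimately have "side_sign A constant_on C"
    using in_components_connected[OF C] by (intro continuous_finite_range_constant)
  then show ?thesis using val unfolding constant_on_def by metis
qed

text \<open>The sign is constant on each face, so its jump across the midpoint of an edge compares the
  signs of the two faces at that edge.\<close>

lemma edge_in_even_subgraph_iff:
  assumes A: "A \<in> even_subgraphs" and ab: "{a, b} \<in> E"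
  shows "{a, b} \<in> A \<longleftrightarrow>
    \<not> ((\<forall>q\<in>left_face a b. side_sign A q = 1) \<longleftrightarrow> (\<forall>q\<in>left_face b a. side_sign A q = 1))"
proof -
  have ba: "{b, a} \<in> E" using ab by (simp add: insert_commute)
  have left: "left_face a b \<in> components (- drawing)" and right: "left_face b a \<in> components (- drawing)"
    using left_face[OF ab] left_face[OF ba] by blast+
  obtain x y where x: "\<And>q. q \<in> left_face a b \<Longrightarrow> side_sign A q = x" "x = 1 \<or> x = - 1"
    and y: "\<And>q. q \<in> left_face b a \<Longrightarrow> side_sign A q = y" "y = 1 \<or> y = - 1"
    using side_sign_on_face[OF A left] side_sign_on_face[OF A right] by metis
  have "\<forall>\<^sub>F s in at_right 0. side_sign A (beside a b (- s)) / side_sign A (beside a b s) = y / x"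
    using eventually_beside_in_left_face[OF ab] eventually_beside_in_left_face[OF ba]
    by eventually_elim (simp add: x(1) y(1) beside_swap[of b a])
  then have lim: "((\<lambda>s. side_sign A (beside a b (- s)) / side_sign A (beside a b s)) \<longlongrightarrow> y / x) (at_right 0)"
    by (rule tendsto_eventually)
  have AE: "A \<subseteq> E" using A by (simp add: even_subgraphs_def)
  have "y / x = (if {a, b} \<in> A then - 1 else 1)"
    by (rule tendsto_unique[OF _ lim side_sign_jump[OF AE ab]]) simp
  then have "{a, b} \<in> A \<longleftrightarrow> x \<noteq> y" using x(2) y(2) by (auto split: if_splits)
  moreover have "(\<forall>q\<in>left_face a b. side_sign A q = 1) \<longleftrightarrow> x = 1"
    using x(1) in_components_nonempty[OF left] by auto
  moreover have "(\<forall>q\<in>left_face b a. side_sign A q = 1) \<longleftrightarrow> y = 1"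
    using y(1) in_components_nonempty[OF right] by auto
  ultimately show ?thesis using x(2) y(2) by auto
qed

text \<open>By the preceding equivalence, the faces of sign \<open>1\<close> determine the even subgraph.\<close>

lemma card_even_subgraphs_le: "card even_subgraphs \<le> 2 ^ card faces"
proof -
  define S where "S A = {C \<in> faces. \<forall>q\<in>C. side_sign A q = 1}" for A
  have "inj_on S even_subgraphs"
  proof (rule inj_onI)
    fix A B assume A: "A \<in> even_subgraphs" and B: "B \<in> even_subgraphs" and eq: "S A = S B"
    have *: "(\<forall>q\<in>left_face a b. side_sign A q = 1) \<longleftrightarrow> (\<forall>q\<in>left_face a b. side_sign B q = 1)"
      if "{a, b} \<in> E" for a b
    proof -
      have "left_face a b \<in> faces" using that by (auto simp: faces_def)
      then show ?thesis using eq unfolding S_def by blast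
    qed
    have iff: "{a, b} \<in> A \<longleftrightarrow> {a, b} \<in> B" if ab: "{a, b} \<in> E" for a b
      using edge_in_even_subgraph_iff[OF A ab] edge_in_even_subgraph_iff[OF B ab]
        *[OF ab] *[of b a] ab by (simp add: insert_commute)
    have "A \<subseteq> E" "B \<subseteq> E" using A B by (auto simp: even_subgraphs_def)
    then show "A = B" using iff edge_cases by (metis subsetD subsetI subset_antisym)
  qed
  moreover have "S ` even_subgraphs \<subseteq> Pow faces" by (auto simp: S_def)
  ultimately have "card even_subgraphs \<le> card (Pow faces)"
    using finite_faces by (intro card_inj_on_le) auto
  then show ?thesis by (simp add: card_Pow finite_faces)
qed

lemma card_edges_less_vertices_plus_faces:
  assumes "V \<noteq> {}"
  shows "card E < card V + card faces"
proof -
  have "2 ^ card E < card even_subgraphs * (2::nat) ^ card V" by (rule many_even_subgraphs[OF assms])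
  also have "\<dots> \<le> 2 ^ card faces * 2 ^ card V" by (intro mult_right_mono card_even_subgraphs_le) simp
  finally have "(2::nat) ^ card E < 2 ^ (card V + card faces)" by (simp add: power_add mult.commute)
  then show ?thesis by simp
qed

end

section \<open>No five-regular graph with unit edges\<close>

lemma finite_orbit:
  assumes "finite D" "f ` D \<subseteq> D" "inj_on f D" "d \<in> D"
  obtains k where "k > 0" "(f ^^ k) d = d" "inj_on (\<lambda>i. (f ^^ i) d) {..<k}" "\<And>i. (f ^^ i) d \<in> D"
proof -
  have inD: "(f ^^ i) d \<in> D" for i using assms(2,4) by (induction i) auto
  have cancel: "(f ^^ m) d = d" if "(f ^^ (i + m)) d = (f ^^ i) d" for i m
    using that
  proof (induction i)
    case (Suc i)
    then have "(f ^^ (i + m)) d = (f ^^ i) d" using inj_onD[OF assms(3) _ inD inD] by auto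
    then show ?case by (rule Suc.IH)
  qed simp
  have diff: "(f ^^ (j - i)) d = d" if "i < j" "(f ^^ i) d = (f ^^ j) d" for i j
    using cancel[of i "j - i"] that by simp
  have "\<not> inj (\<lambda>i. (f ^^ i) d)"
    using finite_subset[of "range (\<lambda>i. (f ^^ i) d)" D] assms(1) inD range_inj_infinite by blast
  then obtain i j where "i < j" "(f ^^ i) d = (f ^^ j) d"
    unfolding inj_def by (metis linorder_neqE_nat)
  then have ex: "\<exists>k. 0 < k \<and> (f ^^ k) d = d" using diff[of i j] by (intro exI[of _ "j - i"]) auto
  define k where "k = (LEAST k. 0 < k \<and> (f ^^ k) d = d)"
  have k: "0 < k" "(f ^^ k) d = d" using LeastI_ex[OF ex] by (auto simp: k_def)
  have least: "k \<le> m" if "0 < m" "(f ^^ m) d = d" for m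
    unfolding k_def by (rule Least_le) (use that in auto)
  have ne: "(f ^^ i) d \<noteq> (f ^^ j) d" if "i < j" "j < k" for i j
    using least[of "j - i"] diff[of i j] that by auto
  have "inj_on (\<lambda>i. (f ^^ i) d) {..<k}"
    by (rule inj_onI) (metis ne lessThan_iff linorder_neqE_nat)
  with k inD show ?thesis using that by blast
qed

context straight_line_graph
begin

text \<open>The successor \<open>\<sigma>\<close> takes a neighbour to the next one in clockwise order, as index \<open>i + 4\<close> is
  \<open>i - 1\<close> modulo 5.\<close>

lemma five_regular_rotation:
  assumes unit: "\<And>a b. {a, b} \<in> E \<Longrightarrow> dist a b = 1" and five: "card (nbrs v) = 5"
  obtains \<sigma> where "bij_betw \<sigma> (nbrs v) (nbrs v)"
    "\<And>u. u \<in> nbrs v \<Longrightarrow> \<sigma> u \<noteq> u" "\<And>u. u \<in> nbrs v \<Longrightarrow> left_face u v = left_face v (\<sigma> u)"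
    "(\<Sum>u\<in>nbrs v. chord_weight (dist u (\<sigma> u))) \<le> 3/2"
proof -
  have "nbrs v \<noteq> {}" using five by auto
  then obtain p where bij: "bij_betw p {..<5} (nbrs v)" and per: "\<And>i. p (i + 5) = p i"
    and turn: "\<And>i. left_face (p (Suc i)) v = left_face v (p i)"
    using rotation_at_vertex[of v] five by metis
  have set5: "{..<5} = {0, 1, 2, 3, 4 :: nat}" by auto
  define prev :: "nat \<Rightarrow> nat" where "prev i = (i + 4) mod 5" for i
  have p_prev: "p (Suc (prev i)) = p i" if "i < 5" for i
  proof -
    have "Suc (prev i) = (if i = 0 then 5 else i)" using that unfolding prev_def by presburger
    then show ?thesis using per[of 0] by simp
  qed
  have bij_prev: "bij_betw prev {..<5} {..<5}"
    unfolding set5 prev_def bij_betw_def inj_on_def by auto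
  define q where "q = inv_into {..<5} p"
  have q: "bij_betw q (nbrs v) {..<5}" unfolding q_def by (rule bij_betw_inv_into[OF bij])
  have qp: "q (p i) = i" if "i < 5" for i
    unfolding q_def using bij_betw_inv_into_left[OF bij] that by simp
  have pq: "p (q u) = u" "q u < 5" if "u \<in> nbrs v" for u
    unfolding q_def using bij_betw_inv_into_right[OF bij] that bij_betwE[OF q] by (auto simp: q_def)
  define \<sigma> where "\<sigma> u = p (prev (q u))" for u
  have "bij_betw (p \<circ> (prev \<circ> q)) (nbrs v) (nbrs v)"
    by (intro bij_betw_trans[OF _ bij] bij_betw_trans[OF q bij_prev])
  then have bij\<sigma>: "bij_betw \<sigma> (nbrs v) (nbrs v)" by (simp add: \<sigma>_def [abs_def] comp_def)
  have ne: "\<sigma> u \<noteq> u" if "u \<in> nbrs v" for u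
  proof
    assume "\<sigma> u = u"
    then have "p (prev (q u)) = p (q u)" using pq[OF that] by (simp add: \<sigma>_def)
    then have "prev (q u) = q u"
      using inj_onD[OF bij_betw_imp_inj_on[OF bij]] pq[OF that] by (simp add: prev_def)
    then show False using pq(2)[OF that] unfolding prev_def by presburger
  qed
  have face: "left_face u v = left_face v (\<sigma> u)" if "u \<in> nbrs v" for u
    using turn[of "prev (q u)"] p_prev[OF pq(2)[OF that]] pq(1)[OF that] by (simp add: \<sigma>_def)
  have pn: "norm (p i - v) = 1" if "i < 5" for i
    using bij_betwE[OF bij] that unit[of v "p i"] by (auto simp: nbrs_def dist_norm norm_minus_commute)
  have "(\<Sum>u\<in>nbrs v. chord_weight (dist u (\<sigma> u))) = (\<Sum>i<5. chord_weight (dist (p i) (\<sigma> (p i))))"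
    by (rule sum.reindex_bij_betw[OF bij, symmetric])
  also have "\<dots> = (\<Sum>i<5. chord_weight (dist (p i) (p (prev i))))"
    by (intro sum.cong refl) (simp add: \<sigma>_def qp)
  also have "\<dots> = chord_weight (dist (p 0) (p 1)) + chord_weight (dist (p 1) (p 2)) + chord_weight (dist (p 2) (p 3))
      + chord_weight (dist (p 3) (p 4)) + chord_weight (dist (p 4) (p 0))"
    unfolding set5 by (simp add: prev_def dist_commute)
  also have "\<dots> = chord_weight (dist (p 0 - v) (p 1 - v)) + chord_weight (dist (p 1 - v) (p 2 - v))
      + chord_weight (dist (p 2 - v) (p 3 - v)) + chord_weight (dist (p 3 - v) (p 4 - v))
      + chord_weight (dist (p 4 - v) (p 0 - v))"
    by (simp add: dist_norm)
  also have "\<dots> \<le> 3/2"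
    by (rule five_corners_weight)
       (use pn bij_betw_imp_inj_on[OF bij] in \<open>auto simp: inj_on_def set5\<close>)
  finally show ?thesis using that bij\<sigma> ne face by blast
qed

lemma deg_eq_card_nbrs: "deg E v = card (nbrs v)"
proof -
  have "bij_betw (\<lambda>u. {v, u}) (nbrs v) {e \<in> E. v \<in> e}"
    unfolding bij_betw_def
  proof
    show "inj_on (\<lambda>u. {v, u}) (nbrs v)" by (auto simp: inj_on_def doubleton_eq_iff)
    show "(\<lambda>u. {v, u}) ` nbrs v = {e \<in> E. v \<in> e}"
    proof
      show "{e \<in> E. v \<in> e} \<subseteq> (\<lambda>u. {v, u}) ` nbrs v"
      proof
        fix e assume e: "e \<in> {e \<in> E. v \<in> e}"
        then obtain u where "e = {v, u}" using edge_cases[of e] by blast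
        then show "e \<in> (\<lambda>u. {v, u}) ` nbrs v" using e by (auto simp: nbrs_def)
      qed
    qed (auto simp: nbrs_def)
  qed
  then show ?thesis by (simp add: deg_def bij_betw_same_card)
qed

text \<open>A directed edge from \<open>u\<close> to \<open>v\<close> stands for the corner at \<open>v\<close> between \<open>u\<close> and its
  successor. Following boundary walks permutes the directed edges without leaving a
  face, so each face contains a whole cycle of this permutation, and the weights along that cycle
  already add up to at least one. Summing the weights by faces and by vertices gives
  \<open>2 * card faces \<le> 3 * card V\<close>.\<close>

lemma not_unit_length_five_regular:
  assumes unit: "\<And>a b. {a, b} \<in> E \<Longrightarrow> dist a b = 1"
    and five: "\<And>v. v \<in> V \<Longrightarrow> deg E v = 5" and "V \<noteq> {}"
  shows False
proof -
  have "\<exists>\<sigma>. bij_betw \<sigma> (nbrs v) (nbrs v) \<and> (\<forall>u\<in>nbrs v. \<sigma> u \<noteq> u) \<and>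
      (\<forall>u\<in>nbrs v. left_face u v = left_face v (\<sigma> u)) \<and>
      (\<Sum>u\<in>nbrs v. chord_weight (dist u (\<sigma> u))) \<le> 3/2" if "v \<in> V" for v
    using five_regular_rotation[OF unit] five[OF that] deg_eq_card_nbrs by metis
  then obtain \<sigma> where bij: "\<And>v. v \<in> V \<Longrightarrow> bij_betw (\<sigma> v) (nbrs v) (nbrs v)"
    and ne: "\<And>v u. v \<in> V \<Longrightarrow> u \<in> nbrs v \<Longrightarrow> \<sigma> v u \<noteq> u"
    and face: "\<And>v u. v \<in> V \<Longrightarrow> u \<in> nbrs v \<Longrightarrow> left_face u v = left_face v (\<sigma> v u)"
    and weight: "\<And>v. v \<in> V \<Longrightarrow> (\<Sum>u\<in>nbrs v. chord_weight (dist u (\<sigma> v u))) \<le> 3/2"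
    by metis
  \<comment> \<open>the pair \<open>(v, u)\<close> represents the edge directed from \<open>u\<close> to \<open>v\<close>\<close>
  define D where "D = Sigma V nbrs"
  define F where "F = (\<lambda>(v, u). left_face u v)"
  define W where "W = (\<lambda>(v, u). chord_weight (dist u (\<sigma> v u)))"
  define nxt where "nxt = (\<lambda>(v, u). (\<sigma> v u, v))"
  have fin_nbrs: "finite (nbrs v)" for v using nbrs_subset finite_V by (rule finite_subset)
  have finD: "finite D" unfolding D_def using finite_V fin_nbrs by (intro finite_SigmaI)
  have dart: "(v, u) \<in> D \<longleftrightarrow> {u, v} \<in> E" for v u
    using edge_subset[of "{u, v}"] by (auto simp: D_def nbrs_def insert_commute)
  have nxtD: "nxt ` D \<subseteq> D"
  proof
    fix d assume "d \<in> nxt ` D"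
    then obtain v u where vu: "v \<in> V" "u \<in> nbrs v" "d = (\<sigma> v u, v)" by (auto simp: nxt_def D_def)
    then have "\<sigma> v u \<in> nbrs v" using bij_betwE[OF bij] by blast
    then show "d \<in> D" unfolding vu(3) dart by (simp add: nbrs_def)
  qed
  have inj: "inj_on nxt D"
  proof (rule inj_onI)
    fix d d' assume d: "d \<in> D" "d' \<in> D" "nxt d = nxt d'"
    then obtain v u u' where vu: "d = (v, u)" "d' = (v, u')" "v \<in> V" "u \<in> nbrs v" "u' \<in> nbrs v" "\<sigma> v u = \<sigma> v u'"
      by (auto simp: D_def nxt_def)
    then show "d = d'" using inj_onD[OF bij_betw_imp_inj_on[OF bij]] by blast
  qed
  have F_nxt: "F (nxt d) = F d" if "d \<in> D" for d
    using that face by (auto simp: D_def F_def nxt_def)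
  have at_least_one: "1 \<le> (\<Sum>d' | d' \<in> D \<and> F d' = F d. W d')" if d: "d \<in> D" for d
  proof -
    obtain k where k: "k > 0" "(nxt ^^ k) d = d" "inj_on (\<lambda>i. (nxt ^^ i) d) {..<k}" and inD: "\<And>i. (nxt ^^ i) d \<in> D"
      using finite_orbit[OF finD nxtD inj d] by metis
    define a where "a i = snd ((nxt ^^ i) d)" for i
    have pair: "(nxt ^^ i) d = (a (Suc i), a i)" for i
      by (cases "(nxt ^^ i) d") (simp add: a_def nxt_def)
    have step: "a (Suc (Suc i)) = \<sigma> (a (Suc i)) (a i)" for i
      using pair[of "Suc i"] pair[of i] by (simp add: nxt_def)
    have ai: "a (Suc i) \<in> V" "a i \<in> nbrs (a (Suc i))" for i
      using inD[of i] unfolding pair by (auto simp: D_def)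
    have "1 \<le> (\<Sum>i<k. chord_weight (dist (a i) (a (Suc (Suc i)))))"
    proof (rule closed_walk_weight[OF _ _ _ k(1)])
      show "dist (a i) (a (Suc i)) = 1" for i
        using ai(2)[of i] unit by (simp add: nbrs_def insert_commute)
      show "a i \<noteq> a (Suc (Suc i))" for i using ne[OF ai] step by metis
      show "a (i + k) = a i" for i by (simp add: a_def funpow_add k(2))
    qed
    also have "\<dots> = (\<Sum>i<k. W ((nxt ^^ i) d))" by (simp add: pair W_def step)
    also have "\<dots> = (\<Sum>d'\<in>(\<lambda>i. (nxt ^^ i) d) ` {..<k}. W d')" by (simp add: sum.reindex[OF k(3)])
    also have "\<dots> \<le> (\<Sum>d' | d' \<in> D \<and> F d' = F d. W d')"
    proof (rule sum_mono2)
      have "F ((nxt ^^ i) d) = F d" for i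
        by (induction i) (simp_all add: F_nxt inD)
      then show "(\<lambda>i. (nxt ^^ i) d) ` {..<k} \<subseteq> {d' \<in> D. F d' = F d}" using inD by auto
      show "0 \<le> W d'" for d'
        using order_trans[OF _ chord_weight_bounds(1), of 0] by (simp add: W_def split: prod.splits)
    qed (use finD in simp)
    finally show ?thesis .
  qed
  have FD: "F ` D = faces"
    unfolding faces_def F_def by (auto simp: dart image_iff; force simp: dart)
  have "real (card faces) = (\<Sum>C\<in>F ` D. 1)" by (simp add: FD)
  also have "\<dots> \<le> (\<Sum>C\<in>F ` D. \<Sum>d' | d' \<in> D \<and> F d' = C. W d')"
    by (intro sum_mono) (use at_least_one in auto)
  also have "\<dots> = (\<Sum>d\<in>D. W d)" by (rule sum.image_gen[OF finD, symmetric])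
  also have "\<dots> = (\<Sum>v\<in>V. \<Sum>u\<in>nbrs v. chord_weight (dist u (\<sigma> v u)))"
    unfolding D_def W_def using finite_V fin_nbrs by (subst sum.Sigma) auto
  also have "\<dots> \<le> (\<Sum>v\<in>V. 3/2)" by (intro sum_mono weight)
  finally have "2 * card faces \<le> 3 * card V" by simp
  moreover have "2 * card E = 5 * card V" using sum_deg[of E] five by simp
  moreover have "card E < card V + card faces" by (rule card_edges_less_vertices_plus_faces[OF \<open>V \<noteq> {}\<close>])
  ultimately show False by linarith
qed

end

text \<open>A point of both segments at distance \<open>s\<close> from \<open>a\<close> is \<open>a + s (b - a)\<close> and
  \<open>a + s (c - a)\<close>.\<close>

lemma unit_segments_meet:
  fixes a b c :: complex
  assumes "dist a b = 1" "dist a c = 1" "b \<noteq> c"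
  shows "closed_segment a b \<inter> closed_segment a c \<subseteq> {a}"
proof
  fix z assume "z \<in> closed_segment a b \<inter> closed_segment a c"
  then have zab: "z \<in> closed_segment a b" and zac: "z \<in> closed_segment a c" by auto
  from zab obtain s where "0 \<le> s" and zb: "z = (1 - s) *\<^sub>R a + s *\<^sub>R b"
    by (auto simp: in_segment)
  from zac obtain t where "0 \<le> t" and zc: "z = (1 - t) *\<^sub>R a + t *\<^sub>R c"
    by (auto simp: in_segment)
  note st = \<open>0 \<le> s\<close> \<open>0 \<le> t\<close>
  have s: "z - a = s *\<^sub>R (b - a)" by (simp add: zb algebra_simps)
  have t: "z - a = t *\<^sub>R (c - a)" by (simp add: zc algebra_simps)
  have "norm (z - a) = s" unfolding s using st assms(1) by (simp add: dist_norm norm_minus_commute)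
  moreover have "norm (z - a) = t" unfolding t using st assms(2) by (simp add: dist_norm norm_minus_commute)
  ultimately have "s *\<^sub>R (b - a) = s *\<^sub>R (c - a)" using s t by metis
  then have "s = 0" using assms(3) by simp
  then show "z \<in> {a}" using s by simp
qed

theorem theorem2p1:
  "\<not> (\<exists>(V :: 'a set) E p. finite V \<and> matchstick_graph V E p \<and> regular_graph 5 V E)"
proof
  assume "\<exists>(V :: 'a set) E p. finite V \<and> matchstick_graph V E p \<and> regular_graph 5 V E"
  then obtain V :: "'a set" and E p where finV: "finite V" and "matchstick_graph V E p" and reg: "regular_graph 5 V E"
    by blast
  then have V: "V \<noteq> {}" and edge: "\<And>e. e \<in> E \<Longrightarrow> e \<subseteq> V \<and> card e = 2" and injp: "inj_on p V"
    and unit: "\<And>u v. {u, v} \<in> E \<Longrightarrow> dist (p u) (p v) = 1"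
    and disjoint: "\<And>u v x y. {u, v} \<in> E \<Longrightarrow> {x, y} \<in> E \<Longrightarrow> {u, v} \<inter> {x, y} = {} \<Longrightarrow>
        closed_segment (p u) (p v) \<inter> closed_segment (p x) (p y) = {}"
    by (auto simp: matchstick_graph_def simple_graph_def)
  define g :: "real^2 \<Rightarrow> complex" where "g x = Complex (x $ 1) (x $ 2)" for x
  define f where "f v = g (p v)" for v
  have g: "linear g" by (rule linearI) (simp_all add: g_def complex_eq_iff)
  have injg: "inj g" by (rule injI) (simp add: g_def vec_eq_iff forall_2)
  have norm_g: "norm (g x) = norm x" for x
    by (simp add: g_def cmod_def norm_vec_def L2_set_def sum_2)
  have injf: "inj_on f V" using injp injg by (auto simp: inj_on_def f_def)
  have unit_f: "dist (f u) (f v) = 1" if "{u, v} \<in> E" for u v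
    using unit[OF that] norm_g[of "p u - p v"] by (simp add: dist_norm f_def linear_diff[OF g])
  have inj_edges: "inj_on ((`) f) E"
    by (rule inj_onI) (metis edge inj_on_image_eq_iff[OF injf])
  interpret straight_line_graph "f ` V" "(`) f ` E"
  proof
    show "finite (f ` V)" using finV by simp
    fix d assume d: "d \<in> (`) f ` E"
    then obtain e where e: "e \<in> E" "d = f ` e" by blast
    show "d \<subseteq> f ` V" using edge e by auto
    show "card d = 2" using edge[OF e(1)] e(2) inj_on_subset[OF injf] by (simp add: card_image)
    fix d' assume d': "d' \<in> (`) f ` E" and ne: "d \<noteq> d'"
    then obtain e' where e': "e' \<in> E" "d' = f ` e'" by blast
    show "convex hull d \<inter> convex hull d' \<subseteq> d \<inter> d'"
    proof (cases "e \<inter> e' = {}")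
      case True
      obtain u v where uv: "e = {u, v}" using edge[OF e(1)] by (auto simp: card_2_iff)
      obtain x y where xy: "e' = {x, y}" using edge[OF e'(1)] by (auto simp: card_2_iff)
      have "convex hull d = g ` closed_segment (p u) (p v)" "convex hull d' = g ` closed_segment (p x) (p y)"
        by (simp_all add: e e' uv xy f_def segment_convex_hull[symmetric] closed_segment_linear_image[OF g])
      then show ?thesis using disjoint[of u v x y] True e(1) e'(1) injg
        by (simp add: uv xy image_Int[symmetric])
    next
      case False
      then obtain u where u: "u \<in> e" "u \<in> e'" by blast
      obtain v where v: "e = {u, v}" using edge[OF e(1)] u(1) by (auto simp: card_2_iff)
      obtain y where y: "e' = {u, y}" using edge[OF e'(1)] u(2) by (auto simp: card_2_iff)
      have "f v \<noteq> f y" using ne by (auto simp: e e' v y)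
      then have "closed_segment (f u) (f v) \<inter> closed_segment (f u) (f y) \<subseteq> {f u}"
        using unit_f e(1) e'(1) v y by (intro unit_segments_meet) auto
      then show ?thesis by (auto simp: e e' v y segment_convex_hull)
    qed
  qed
  show False
  proof (rule not_unit_length_five_regular)
    show "f ` V \<noteq> {}" using V by simp
    fix a b assume ab: "{a, b} \<in> (`) f ` E"
    then obtain e where e: "e \<in> E" "{a, b} = f ` e" by blast
    obtain u v where uv: "e = {u, v}" using edge[OF e(1)] by (auto simp: card_2_iff)
    have "a = f u \<and> b = f v \<or> a = f v \<and> b = f u" using e(2) by (simp add: uv doubleton_eq_iff)
    then show "dist a b = 1" using unit_f[of u v] e(1) by (auto simp: uv dist_commute)
  next
    fix w assume "w \<in> f ` V"
    then obtain v where v: "v \<in> V" "w = f v" by blast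
    have "{d \<in> (`) f ` E. w \<in> d} = (`) f ` {e \<in> E. v \<in> e}"
      using v inj_on_image_mem_iff[OF injf v(1)] edge by auto
    moreover have "card ((`) f ` {e \<in> E. v \<in> e}) = card {e \<in> E. v \<in> e}"
      by (intro card_image inj_on_subset[OF inj_edges]) auto
    ultimately show "deg ((`) f ` E) w = 5"
      using reg v(1) by (simp add: deg_def regular_graph_def)
  qed
qed

end
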